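(* Suppose $\alpha>-1$, $p>\alpha+2$, and $\beta$ is the real number determined by $2(\beta+1)=p+\alpha$. Then the symmetric lifting operator $L$ maps $A^p_\alpha(\mathbb{D})$ boundedly into $A^p_\beta(\mathbb{D}^2)$.
   Context: $\mathbb{D}$ is the open unit disk in $\mathbb{C}$, $\mathbb{D}^2=\mathbb{D}\times\mathbb{D}$ is the bidisk in $\mathbb{C}^2$, and $H(\mathbb{D})$, $H(\mathbb{D}^2)$ are the spaces of all holomorphic functions on $\mathbb{D}$ and $\mathbb{D}^2$. $dA$ is the normalized area measure on $\mathbb{D}$ (so $A(\mathbb{D})=1$), and for $\gamma>-1$, $dA_\gamma(z)=(\gamma+1)(1-|z|^2)^\gamma\,dA(z)$. For $p>0$ and $\gamma>-1$, $A^p_\gamma(\mathbb{D})$ is the space of $f\in H(\mathbb{D})$ with $\int_{\mathbb{D}}|f(z)|^p\,dA_\gamma(z)<\infty$, and $A^p_\gamma(\mathbb{D}^2)$ is the space of $f\in H(\mathbb{D}^2)$ with $\int_{\mathbb{D}}\int_{\mathbb{D}}|f(z,w)|^p\,dA_\gamma(z)\,dA_\gamma(w)<\infty$. The symmetric lifting operator $L:H(\mathbb{D})\to H(\mathbb{D}^2)$ is defined by $L(f)(z,w)=\frac{f(z)-f(w)}{z-w}$ for $z\neq w$, extended holomorphically to the diagonal (so $L(f)(z,z)=f'(z)$). That $L$ maps $A^p_\alpha(\mathbb{D})$ boundedly into $A^p_\beta(\mathbb{D}^2)$ means that there is a constant $C>0$ such that $\int_{\mathbb{D}}\int_{\mathbb{D}}|L(f)(z,w)|^p\,dA_\beta(z)\,dA_\beta(w)\le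 C\int_{\mathbb{D}}|f(z)|^p\,dA_\alpha(z)$ for all $f\in A^p_\alpha(\mathbb{D})$. *)

theory Defs
  imports "HOL-Complex_Analysis.Complex_Analysis"
begin

abbreviation unit_disc :: "complex set" where
  "unit_disc \<equiv> ball 0 1"

text \<open>The measures are restricted to the unit disc as a space, so that functions only need to be
  measurable there: functions on the disc are represented by total functions whose values
  elsewhere are arbitrary.\<close>

definition area_measure :: "complex measure" where
  "area_measure = uniform_measure (restrict_space lborel unit_disc) unit_disc"

definition weighted_area :: "real \<Rightarrow> complex measure" where
  "weighted_area \<gamma> = density area_measure
     (\<lambda>z. ennreal ((\<gamma> + 1) * (1 - (cmod z)\<^sup>2) powr \<gamma>))"

text \<open>Holomorphy in two variables on an open set is complex differentiability: the real Frechet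
  derivative exists and is complex linear, i.e. of the form below.\<close>

definition holomorphic2_on :: "(complex \<times> complex \<Rightarrow> complex) \<Rightarrow> (complex \<times> complex) set \<Rightarrow> bool"
    (infixl "holomorphic2'_on" 50) where
  "F holomorphic2_on S \<longleftrightarrow>
     (\<forall>x\<in>S. \<exists>a b. (F has_derivative (\<lambda>(h, k). a * h + b * k)) (at x))"

text \<open>The $p$-th powers of the Bergman norms, as extended nonnegative reals.\<close>

definition bergman_int :: "real \<Rightarrow> real \<Rightarrow> (complex \<Rightarrow> complex) \<Rightarrow> ennreal" where
  "bergman_int p \<gamma> f = (\<integral>\<^sup>+z. ennreal (cmod (f z) powr p) \<partial>weighted_area \<gamma>)"

definition bergman_int2 :: "real \<Rightarrow> real \<Rightarrow> (complex \<times> complex \<Rightarrow> complex) \<Rightarrow> ennreal" where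
  "bergman_int2 p \<gamma> F =
     (\<integral>\<^sup>+w. (\<integral>\<^sup>+z. ennreal (cmod (F (z, w)) powr p) \<partial>weighted_area \<gamma>) \<partial>weighted_area \<gamma>)"

definition bergman_space :: "real \<Rightarrow> real \<Rightarrow> (complex \<Rightarrow> complex) set" where
  "bergman_space p \<gamma> = {f. f holomorphic_on unit_disc \<and> bergman_int p \<gamma> f < \<infinity>}"

definition bergman_space2 :: "real \<Rightarrow> real \<Rightarrow> (complex \<times> complex \<Rightarrow> complex) set" where
  "bergman_space2 p \<gamma> =
     {F. F holomorphic2_on (unit_disc \<times> unit_disc) \<and> bergman_int2 p \<gamma> F < \<infinity>}"

definition symmetric_lifting :: "(complex \<Rightarrow> complex) \<Rightarrow> complex \<times> complex \<Rightarrow> complex" where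
  "symmetric_lifting f = (\<lambda>(z, w). if z = w then deriv f z else (f z - f w) / (z - w))"

end

theory Submission
  imports Defs
begin

text \<open>
  Write \<open>W z = 1 - (cmod z)\<^sup>2\<close> and \<open>D(z,w) = (1 - cmod z) + (1 - cmod w) + cmod (z - w)\<close>. If \<open>z\<close> stays
  away from \<open>w\<close>, in the sense that \<open>cmod (z - w) \<ge> (1 - cmod w) / 4\<close>, then \<open>cmod (z - w)\<close> is comparable to
  \<open>D(z,w)\<close>, and up to a constant the \<open>p\<close>-th power of the difference quotient is at most
  \<open>(cmod (f z) powr p + cmod (f w) powr p) * D(z,w) powr (- p)\<close>. Multiply by the weights
  \<open>W z powr \<beta>\<close> and \<open>W w powr \<beta>\<close> and integrate the term with \<open>f z\<close> over \<open>w\<close> first. The Forelli--Rudin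
  type estimate \<open>disc_gauge_integral\<close> bounds the integral of \<open>W w powr \<beta> * D(z,w) powr (- p)\<close> by a multiple of
  \<open>W z powr (\<beta> + 2 - p)\<close>; it needs \<open>\<beta> > -1\<close> and \<open>p > \<beta> + 2\<close>, and the latter is the hypothesis
  \<open>p > \<alpha> + 2\<close> in disguise. What is left is the integral of \<open>cmod (f z) powr p\<close> against \<open>W z\<close> to the
  power \<open>2 * \<beta> + 2 - p = \<alpha>\<close>. The term with \<open>f w\<close> is the same by symmetry.

  Near the diagonal that bound loses the cancellation in the numerator. For fixed \<open>w\<close> the
  lifting is a holomorphic function of \<open>z\<close>, also at \<open>z = w\<close>. The \<open>p\<close>-th power of its modulus is
  subharmonic, so by \<open>weighted_inner_disc_le_annulus\<close> its integral over a small disc about \<open>w\<close> is at most a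
  constant times its integral over a surrounding annulus, and the annulus is away from the diagonal.
  The lemma \<open>symmetric_lifting_slice_bound\<close> combines both regions.

  Holomorphy of the lifting in two variables is elementary off the diagonal; on the diagonal it follows from the
  second-order Taylor expansion of \<open>f\<close>.
\<close>

section \<open>Area in the complex plane\<close>

lemma unit_disc_in_borel [measurable]: "unit_disc \<in> sets borel"
  by simp

text \<open>Both measures give a rectangle the product of its side lengths, and that determines a
  measure on the Borel sets.\<close>

lemma lborel_complex_eq_distr:
  "(lborel :: complex measure) = distr (lborel \<Otimes>\<^sub>M lborel) borel (\<lambda>(x, y). Complex x y)"
proof (rule lborel_eqI)
  have [measurable]: "(\<lambda>(x, y). Complex x y) \<in> borel_measurable (lborel \<Otimes>\<^sub>M lborel)"
    unfolding complex_eq_iff Complex_eq split_beta' by measurable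
  fix l u :: complex assume le: "\<And>b. b \<in> Basis \<Longrightarrow> l \<bullet> b \<le> u \<bullet> b"
  have le': "Re l \<le> Re u" "Im l \<le> Im u"
    using le[of 1] le[of \<i>] by (auto simp: Basis_complex_def inner_complex_def)
  have "emeasure (distr (lborel \<Otimes>\<^sub>M lborel) borel (\<lambda>(x, y). Complex x y)) (box l u)
     = emeasure (lborel \<Otimes>\<^sub>M lborel) ({Re l<..<Re u} \<times> {Im l<..<Im u})"
    by (subst emeasure_distr)
       (auto intro!: arg_cong2[where f=emeasure] simp: space_pair_measure box_def Basis_complex_def inner_complex_def)
  also have "\<dots> = ennreal (\<Prod>b\<in>Basis. (u - l) \<bullet> b)"
    using le' by (subst lborel.emeasure_pair_measure_Times)
      (auto simp: Basis_complex_def inner_complex_def ennreal_mult)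
  finally show "emeasure (distr (lborel \<Otimes>\<^sub>M lborel) borel (\<lambda>(x, y). Complex x y)) (box l u)
     = (\<Prod>b\<in>Basis. (u - l) \<bullet> b)" .
qed simp

lemma measurable_Complex [measurable (raw)]:
  fixes f g :: "'a \<Rightarrow> real"
  assumes "f \<in> borel_measurable M" "g \<in> borel_measurable M"
  shows "(\<lambda>x. Complex (f x) (g x)) \<in> borel_measurable M"
  using assms unfolding Complex_eq by measurable

lemma nn_integral_complex_iterated:
  fixes h :: "complex \<Rightarrow> ennreal"
  assumes [measurable]: "h \<in> borel_measurable borel"
  shows "(\<integral>\<^sup>+z. h z \<partial>lborel) = (\<integral>\<^sup>+y. \<integral>\<^sup>+x. h (Complex x y) \<partial>lborel \<partial>lborel)"
    and "(\<integral>\<^sup>+z. h z \<partial>lborel) = (\<integral>\<^sup>+x. \<integral>\<^sup>+y. h (Complex x y) \<partial>lborel \<partial>lborel)"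
proof -
  have m: "(\<lambda>(x, y). h (Complex x y)) \<in> borel_measurable (lborel \<Otimes>\<^sub>M lborel)"
    by measurable
  have "(\<integral>\<^sup>+z. h z \<partial>lborel) = (\<integral>\<^sup>+p. h (case p of (x, y) \<Rightarrow> Complex x y) \<partial>(lborel \<Otimes>\<^sub>M lborel))"
    by (subst lborel_complex_eq_distr, subst nn_integral_distr) auto
  also have "\<dots> = (\<integral>\<^sup>+x. \<integral>\<^sup>+y. h (Complex x y) \<partial>lborel \<partial>lborel)"
    using lborel.nn_integral_fst[OF m] by (simp add: split_beta')
  finally show *: "(\<integral>\<^sup>+z. h z \<partial>lborel) = (\<integral>\<^sup>+x. \<integral>\<^sup>+y. h (Complex x y) \<partial>lborel \<partial>lborel)" .
  show "(\<integral>\<^sup>+z. h z \<partial>lborel) = (\<integral>\<^sup>+y. \<integral>\<^sup>+x. h (Complex x y) \<partial>lborel \<partial>lborel)"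
    unfolding * using lborel_pair.Fubini'[OF m] by simp
qed

lemma nn_integral_shear:
  fixes h :: "complex \<Rightarrow> ennreal" and a :: real
  assumes [measurable]: "h \<in> borel_measurable borel"
  shows "(\<integral>\<^sup>+z. h (Complex (Re z + a * Im z) (Im z)) \<partial>lborel) = (\<integral>\<^sup>+z. h z \<partial>lborel)"
    and "(\<integral>\<^sup>+z. h (Complex (Re z) (Im z + a * Re z)) \<partial>lborel) = (\<integral>\<^sup>+z. h z \<partial>lborel)"
proof -
  have "(\<integral>\<^sup>+x. h (Complex (x + a * y) y) \<partial>lborel) = (\<integral>\<^sup>+x. h (Complex x y) \<partial>lborel)" for y
    by (subst (2) nn_integral_real_affine[where c=1 and t="a * y"]) (auto simp: add.commute)
  then show "(\<integral>\<^sup>+z. h (Complex (Re z + a * Im z) (Im z)) \<partial>lborel) = (\<integral>\<^sup>+z. h z \<partial>lborel)"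
    by (subst (1 2) nn_integral_complex_iterated(1)) auto
  have "(\<integral>\<^sup>+y. h (Complex x (y + a * x)) \<partial>lborel) = (\<integral>\<^sup>+y. h (Complex x y) \<partial>lborel)" for x
    by (subst (2) nn_integral_real_affine[where c=1 and t="a * x"]) (auto simp: add.commute)
  then show "(\<integral>\<^sup>+z. h (Complex (Re z) (Im z + a * Re z)) \<partial>lborel) = (\<integral>\<^sup>+z. h z \<partial>lborel)"
    by (subst (1 2) nn_integral_complex_iterated(2)) auto
qed

text \<open>By the two-variable iterated integral and translation invariance on the line, shears preserve
  area. A rotation with angle \<open>\<theta>\<close> other than the half turn is the product of a horizontal shear by
  \<open>- tan (\<theta>/2)\<close>, a vertical shear by \<open>sin \<theta>\<close>, and the same horizontal shear again.\<close>

lemma nn_integral_rotation: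
  fixes h :: "complex \<Rightarrow> ennreal" and \<omega> :: complex
  assumes h: "h \<in> borel_measurable borel" and \<omega>: "cmod \<omega> = 1"
  shows "(\<integral>\<^sup>+z. h (\<omega> * z) \<partial>lborel) = (\<integral>\<^sup>+z. h z \<partial>lborel)"
proof -
  have *: "(\<integral>\<^sup>+z. h (\<omega> * z) \<partial>lborel) = (\<integral>\<^sup>+z. h z \<partial>lborel)"
    if h [measurable]: "h \<in> borel_measurable borel" and \<omega>: "cmod \<omega> = 1" and ne: "\<omega> \<noteq> -1" 
    for h :: "complex \<Rightarrow> ennreal" and \<omega> :: complex
  proof -
    define c s where "c = Re \<omega>" and "s = Im \<omega>"
    have cs: "c\<^sup>2 + s\<^sup>2 = 1" using \<omega> by (simp add: c_def s_def cmod_def)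
    have c: "1 + c \<noteq> 0"
    proof
      assume "1 + c = 0"
      then have "c = -1" by simp
      with cs have "s = 0" by simp
      with \<open>c = -1\<close> ne show False by (auto simp: c_def s_def complex_eq_iff)
    qed
    \<comment> \<open>This is the tangent of half the angle.\<close>
    define t where "t = s / (1 + c)"
    have t1: "c = 1 - t * s" and t2: "- s = - 2 * t + s * t\<^sup>2"
    proof -
      show "c = 1 - t * s" using c cs unfolding t_def
        by (simp add: field_simps power2_eq_square)
      then have "1 - t * s = c" by simp
      have "- 2 * t + s * t\<^sup>2 = - t - t * (1 - t * s)" by (simp add: power2_eq_square algebra_simps)
      also have "\<dots> = - t * (1 + c)" unfolding \<open>1 - t * s = c\<close> by (simp add: algebra_simps)
      also have "\<dots> = - s" using c by (simp add: t_def)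
      finally show "- s = - 2 * t + s * t\<^sup>2" by simp
    qed
    define X where "X = (\<lambda>z. Complex (Re z + (- t) * Im z) (Im z))"
    define Y where "Y = (\<lambda>z. Complex (Re z) (Im z + s * Re z))"
    have [measurable]: "X \<in> borel_measurable borel" "Y \<in> borel_measurable borel"
      unfolding X_def Y_def by measurable
    have rot: "\<omega> * z = X (Y (X z))" for z
    proof -
      have "Re (X (Y (X z))) = (1 - t * s) * Re z + (- 2 * t + s * t\<^sup>2) * Im z"
        by (simp add: X_def Y_def algebra_simps power2_eq_square)
      moreover have "Im (X (Y (X z))) = s * Re z + (1 - t * s) * Im z"
        by (simp add: X_def Y_def algebra_simps)
      ultimately show ?thesis
        unfolding t1[symmetric] t2[symmetric] by (simp add: complex_eq_iff c_def s_def)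
    qed
    have X: "(\<integral>\<^sup>+z. k (X z) \<partial>lborel) = (\<integral>\<^sup>+z. k z \<partial>lborel)"
      and Y: "(\<integral>\<^sup>+z. k (Y z) \<partial>lborel) = (\<integral>\<^sup>+z. k z \<partial>lborel)"
      if "k \<in> borel_measurable borel" for k :: "complex \<Rightarrow> ennreal"
      using nn_integral_shear[OF that] unfolding X_def Y_def by blast+
    have "(\<integral>\<^sup>+z. h (\<omega> * z) \<partial>lborel) = (\<integral>\<^sup>+z. h (X (Y (X z))) \<partial>lborel)"
      by (simp add: rot)
    also have "\<dots> = (\<integral>\<^sup>+z. h z \<partial>lborel)"
      by (simp add: X[of "\<lambda>z. h (X (Y z))"] Y[of "\<lambda>z. h (X z)"] X[of h])
    finally show ?thesis .
  qed
  show ?thesis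
  proof (cases "\<omega> = -1")
    case True
    \<comment> \<open>The shears degenerate for the half turn, which is the square of a quarter turn.\<close>
    have i: "\<i> \<noteq> - 1" by (simp add: complex_eq_iff)
    have "(\<integral>\<^sup>+z. h (\<omega> * z) \<partial>lborel) = (\<integral>\<^sup>+z. (\<lambda>z. h (\<i> * z)) (\<i> * z) \<partial>lborel)"
      using True by (simp flip: mult.assoc)
    also have "\<dots> = (\<integral>\<^sup>+z. h (\<i> * z) \<partial>lborel)"
      using h i by (intro *) auto
    also have "\<dots> = (\<integral>\<^sup>+z. h z \<partial>lborel)"
      using h i by (intro *) auto
    finally show ?thesis .
  qed (use * h \<omega> in auto)
qed

section \<open>Subharmonicity of powers of the modulus\<close>

lemma powr_above_tangent:
  fixes a A p :: real
  assumes "p \<ge> 1" "a \<ge> 0" "A > 0"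
  shows "A powr p + p * A powr (p - 1) * (a - A) \<le> a powr p"
proof (cases "a = 0")
  case True
  have "A powr (p - 1) * A = A powr p"
    using assms by (simp add: powr_diff)
  then have "A powr p + p * A powr (p - 1) * (a - A) = (1 - p) * A powr p"
    by (simp add: True algebra_simps)
  also have "\<dots> \<le> 0" using assms by (simp add: mult_nonpos_nonneg)
  finally show ?thesis using assms True by simp
next
  case False
  have "(\<lambda>x. x powr p) a - (\<lambda>x. x powr p) A \<ge> (p * A powr (p - 1)) * (a - A)"
  proof (rule convex_on_imp_above_tangent[where A="{0<..}"])
    show "convex_on {0<..} (\<lambda>x::real. x powr p)"
      using assms by (intro convex_on_subset[OF powr_convex]) auto
    show "((\<lambda>x. x powr p) has_field_derivative p * A powr (p - 1)) (at A within {0<..})"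
      using assms by (auto intro!: derivative_eq_intros)
    show "A \<in> interior {0<..}" using assms by (subst interior_open) auto
  qed (use assms False in auto)
  then show ?thesis by simp
qed

text \<open>Jensen's inequality for the mean value property. After a unimodular factor makes \<open>h 0\<close> equal to
  \<open>A > 0\<close>, the real part \<open>R\<close> of \<open>h\<close> has mean \<open>A\<close> over the circle, so the tangent to
  \<open>x \<mapsto> x powr p\<close> at \<open>A\<close>, evaluated at \<open>R\<close>, has mean \<open>A powr p\<close>. Since \<open>R \<le> cmod h\<close> and the tangent
  increases and stays below the convex function, \<open>cmod h powr p\<close> has at least this mean.\<close>

lemma powr_norm_le_circle_mean:
  fixes h :: "complex \<Rightarrow> complex" and p :: real
  assumes h: "h holomorphic_on cball 0 1" and p: "p \<ge> 1"
  shows "ennreal (2 * pi * cmod (h 0) powr p)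
       \<le> (\<integral>\<^sup>+t. ennreal (cmod (h (cis t)) powr p) * indicator {0..2 * pi} t \<partial>lborel)"
proof (cases "h 0 = 0")
  case False
  define A where "A = cmod (h 0)"
  have A: "A > 0" using False by (simp add: A_def)
  have "((\<lambda>u. h u / (u - 0)) has_contour_integral 2 * of_real pi * \<i> * h 0) (circlepath 0 1)"
    using h by (intro Cauchy_integral_circlepath_simple) auto
  then have "((\<lambda>t. h (0 + of_real 1 * cis t) / (0 + of_real 1 * cis t - 0) * of_real 1 * \<i> * cis t)
      has_integral 2 * of_real pi * \<i> * h 0) {0..2 * pi}"
    unfolding circlepath_def by (subst (asm) has_contour_integral_part_circlepath_iff) auto
  then have "((\<lambda>t. \<i> * h (cis t)) has_integral \<i> * (2 * of_real pi * h 0)) {0..2 * pi}"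
    by (simp add: field_simps)
  from has_integral_mult_right[OF this, of "- \<i> * cnj (h 0) / of_real A"]
  have "((\<lambda>t. cnj (h 0) / of_real A * h (cis t)) has_integral
      cnj (h 0) / of_real A * (2 * of_real pi * h 0)) {0..2 * pi}"
    by (simp add: field_simps)
  also have "cnj (h 0) / of_real A * (2 * of_real pi * h 0) = of_real (2 * pi * A)"
  proof -
    have "cnj (h 0) * h 0 = of_real A * of_real A"
      using complex_norm_square[of "h 0"] by (simp add: A_def power2_eq_square mult.commute)
    then have "cnj (h 0) / of_real A * (2 * of_real pi * h 0) = 2 * of_real pi * (of_real A * of_real A) / of_real A"
      by (simp add: mult.assoc mult.left_commute)
    then show ?thesis using A by simp
  qed
  finally have mean: "((\<lambda>t. cnj (h 0) / of_real A * h (cis t)) has_integral of_real (2 * pi * A)) {0..2 * pi}" .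
  define R where "R = (\<lambda>t. Re (cnj (h 0) / of_real A * h (cis t)))"
  have "(R has_integral 2 * pi * A) {0..2 * pi}"
    using has_integral_linear[OF mean bounded_linear_Re] unfolding R_def o_def Re_complex_of_real .
  \<comment> \<open>The tangent line at \<open>A\<close>, composed with \<open>R\<close>.\<close>
  from has_integral_add[OF has_integral_mult_right[OF this, of "p * A powr (p - 1)"]
      has_integral_const_real[of "A powr p - p * A powr (p - 1) * A" 0 "2 * pi"]]
  have lin: "((\<lambda>t. p * A powr (p - 1) * R t + (A powr p - p * A powr (p - 1) * A))
     has_integral (p * A powr (p - 1) * (2 * pi * A) + measure lborel {0..2 * pi} *\<^sub>R (A powr p - p * A powr (p - 1) * A))) {0..2 * pi}" .
  have cont: "continuous_on {0..2 * pi} (\<lambda>t. cmod (h (cis t)) powr p)"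
    using p by (intro continuous_intros continuous_on_powr' 
        continuous_on_compose2[OF holomorphic_on_imp_continuous_on[OF h]]) auto
  then obtain I where I: "((\<lambda>t. cmod (h (cis t)) powr p) has_integral I) {0..2 * pi}"
    using integrable_continuous_interval by blast
  have "2 * pi * A powr p = p * A powr (p - 1) * (2 * pi * A) + measure lborel {0..2 * pi} *\<^sub>R (A powr p - p * A powr (p - 1) * A)"
    by (simp add: algebra_simps)
  also have "\<dots> \<le> I"
  proof (rule has_integral_le[OF lin I])
    fix t assume "t \<in> {0..2 * pi}"
    have "R t \<le> cmod (cnj (h 0) / of_real A * h (cis t))"
      unfolding R_def by (rule complex_Re_le_cmod)
    also have "\<dots> = cmod (h (cis t))"
      using A by (simp add: norm_mult norm_divide A_def)
    finally have "p * A powr (p - 1) * R t \<le> p * A powr (p - 1) * cmod (h (cis t))"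
      using p by (intro mult_left_mono) auto
    then show "p * A powr (p - 1) * R t + (A powr p - p * A powr (p - 1) * A)
       \<le> cmod (h (cis t)) powr p"
      using powr_above_tangent[OF p _ A, of "cmod (h (cis t))"] by (simp add: algebra_simps)
  qed
  finally have "ennreal (2 * pi * A powr p) \<le> ennreal I" by (rule ennreal_leI)
  also have "ennreal I = (\<integral>\<^sup>+t. ennreal (cmod (h (cis t)) powr p) * indicator {0..2 * pi} t \<partial>lborel)"
    by (rule nn_integral_has_integral_lebesgue'[OF _ I, symmetric]) auto
  finally show ?thesis by (simp add: A_def)
qed auto

lemma nn_integral_lborel_translate:
  fixes h :: "complex \<Rightarrow> ennreal"
  assumes [measurable]: "h \<in> borel_measurable borel"
  shows "(\<integral>\<^sup>+u. h (c + u) \<partial>lborel) = (\<integral>\<^sup>+z. h z \<partial>lborel)"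
  by (subst (2) lborel_distr_plus[of c, symmetric], subst nn_integral_distr) auto

text \<open>The circle inequality, applied to \<open>\<zeta> \<mapsto> g (c + u * \<zeta>)\<close> and integrated over all \<open>u\<close> in the disc. When the two
  integrations are exchanged, rotation invariance makes the integral over \<open>u\<close> independent of the
  angle.\<close>

lemma powr_norm_submean_disc:
  fixes g :: "complex \<Rightarrow> complex" and p r :: real
  assumes g: "g holomorphic_on ball c r" and p: "p \<ge> 1"
  shows "ennreal (cmod (g c) powr p) * emeasure lborel (ball c r)
       \<le> (\<integral>\<^sup>+z. ennreal (cmod (g z) powr p) * indicator (ball c r) z \<partial>lborel)"
proof -
  \<comment> \<open>Extension by zero makes the integrand Borel measurable on the whole plane.\<close>
  define k where "k = (\<lambda>z. ennreal (if z \<in> ball c r then cmod (g z) powr p else 0))"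
  have k [measurable]: "k \<in> borel_measurable borel"
    unfolding k_def using p
    by (intro measurable_compose[OF _ measurable_ennreal] borel_measurable_continuous_on_if
          continuous_intros continuous_on_powr' holomorphic_on_imp_continuous_on[OF g]) auto
  have k_eq: "k z = ennreal (cmod (g z) powr p) * indicator (ball c r) z" for z
    by (simp add: k_def indicator_def)
  have circ: "ennreal (2 * pi * cmod (g c) powr p) * indicator (ball 0 r) u
      \<le> (\<integral>\<^sup>+t. k (c + cis t * u) * indicator {0..2 * pi} t \<partial>lborel)" for u
  proof (cases "u \<in> ball 0 r")
    case True
    have im: "c + u * \<zeta> \<in> ball c r" if "\<zeta> \<in> cball 0 1" for \<zeta>
    proof -
      have "cmod u * cmod \<zeta> \<le> cmod u * 1" using that by (intro mult_left_mono) auto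
      then show ?thesis using True by (auto simp: dist_norm norm_mult)
    qed
    have "(\<lambda>\<zeta>. g (c + u * \<zeta>)) holomorphic_on cball 0 1"
      using im by (intro holomorphic_on_compose_gen[OF _ g, unfolded o_def] holomorphic_intros) auto
    from powr_norm_le_circle_mean[OF this p]
    have "ennreal (2 * pi * cmod (g c) powr p)
      \<le> (\<integral>\<^sup>+t. ennreal (cmod (g (c + u * cis t)) powr p) * indicator {0..2 * pi} t \<partial>lborel)"
      by simp
    also have "\<dots> = (\<integral>\<^sup>+t. k (c + cis t * u) * indicator {0..2 * pi} t \<partial>lborel)"
      using im[of "cis _"] by (intro nn_integral_cong) (simp add: k_def mult.commute)
    finally show ?thesis using True by simp
  qed auto
  have m: "(\<lambda>(u, t). k (c + cis t * u) * indicator {0..2 * pi} t) \<in> borel_measurable (lborel \<Otimes>\<^sub>M lborel)"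
    unfolding cis.code by measurable
  have "ennreal (2 * pi) * (ennreal (cmod (g c) powr p) * emeasure lborel (ball c r))
      = (\<integral>\<^sup>+u. ennreal (2 * pi * cmod (g c) powr p) * indicator (ball (0::complex) r) u \<partial>lborel)"
  proof -
    have "emeasure lborel (ball c r) = emeasure lborel (ball (0::complex) r)"
      by (cases "r \<ge> 0") (auto simp: emeasure_ball ball_empty)
    moreover have "ennreal (2 * pi * cmod (g c) powr p) = ennreal (2 * pi) * ennreal (cmod (g c) powr p)"
      by (rule ennreal_mult) auto
    ultimately show ?thesis by (subst nn_integral_cmult_indicator) (simp_all add: mult.assoc)
  qed
  also have "\<dots> \<le> (\<integral>\<^sup>+u. \<integral>\<^sup>+t. k (c + cis t * u) * indicator {0..2 * pi} t \<partial>lborel \<partial>lborel)"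
    by (intro nn_integral_mono circ)
  also have "\<dots> = (\<integral>\<^sup>+t. \<integral>\<^sup>+u. k (c + cis t * u) * indicator {0..2 * pi} t \<partial>lborel \<partial>lborel)"
    using lborel_pair.Fubini'[OF m] by simp
  also have "\<dots> = (\<integral>\<^sup>+t. (\<integral>\<^sup>+z. k z \<partial>lborel) * indicator {0..2 * pi} t \<partial>lborel)"
  proof (intro nn_integral_cong)
    fix t :: real
    have "(\<integral>\<^sup>+u. k (c + cis t * u) * indicator {0..2 * pi} t \<partial>lborel)
        = (\<integral>\<^sup>+u. k (c + cis t * u) \<partial>lborel) * indicator {0..2 * pi} t"
      by (rule nn_integral_multc) measurable
    also have "(\<integral>\<^sup>+u. k (c + cis t * u) \<partial>lborel) = (\<integral>\<^sup>+u. k (c + u) \<partial>lborel)"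
      by (rule nn_integral_rotation) auto
    also have "\<dots> = (\<integral>\<^sup>+z. k z \<partial>lborel)"
      by (rule nn_integral_lborel_translate) measurable
    finally show "(\<integral>\<^sup>+u. k (c + cis t * u) * indicator {0..2 * pi} t \<partial>lborel)
        = (\<integral>\<^sup>+z. k z \<partial>lborel) * indicator {0..2 * pi} t" .
  qed
  also have "\<dots> = ennreal (2 * pi) * (\<integral>\<^sup>+z. k z \<partial>lborel)"
    by (simp add: nn_integral_cmult mult.commute)
  finally show ?thesis
    by (simp add: ennreal_mult_le_mult_iff k_eq)
qed

section \<open>Integrals over a disc and a surrounding annulus\<close>

text \<open>A power with exponent \<open>b \<ge> 0\<close> is increasing and uses \<open>s \<le> K * t\<close>; a negative exponent uses
  \<open>t \<le> K * s\<close>.\<close>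

lemma powr_comparable:
  fixes s t b K :: real
  assumes "s > 0" "t > 0" "s \<le> K * t" "t \<le> K * s" "K > 0"
  shows "s powr b \<le> K powr \<bar>b\<bar> * t powr b"
proof (cases "b \<ge> 0")
  case True
  have "s powr b \<le> (K * t) powr b" using assms True by (intro powr_mono2) auto
  then show ?thesis using assms True by (simp add: powr_mult)
next
  case False
  have "s powr b \<le> (t / K) powr b" using assms False by (intro powr_mono2') (auto simp: field_simps)
  then show ?thesis using assms False by (simp add: powr_divide powr_minus field_simps)
qed

text \<open>By the maximum principle it suffices to bound \<open>cmod g\<close> on the circle of radius \<open>3 * R / 4\<close>. A disc
  of radius \<open>R / 4\<close> centred on that circle lies in the annulus, so the sub-mean value inequality
  applies there.\<close>

lemma powr_norm_inner_disc_le_annulus: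
  fixes g :: "complex \<Rightarrow> complex" and p R :: real
  assumes g: "g holomorphic_on ball w R" and p: "p \<ge> 1" and R: "R > 0" and z: "z \<in> ball w (R / 2)"
  shows "ennreal (cmod (g z) powr p) * emeasure lborel (ball w (R / 4))
       \<le> (\<integral>\<^sup>+\<zeta>. ennreal (cmod (g \<zeta>) powr p) * indicator (ball w R - ball w (R / 2)) \<zeta> \<partial>lborel)"
    (is "_ \<le> ?J")
proof (cases "?J = top")
  case False
  then obtain j where j: "?J = ennreal j" "j \<ge> 0" by (cases ?J) auto
  define e where "e = pi * (R / 4)\<^sup>2"
  have e: "e > 0" using R by (simp add: e_def)
  have E: "emeasure lborel (ball c (R / 4)) = ennreal e" for c :: complex
    using R by (simp add: e_def emeasure_ball unit_ball_vol_2)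
  \<comment> \<open>The maximum principle bounds \<open>cmod g\<close>, so the bound is put in the form of a \<open>p\<close>-th root.\<close>
  have circle: "cmod (g \<zeta>) \<le> (j / e) powr (1 / p)" if \<zeta>: "dist w \<zeta> = 3 * R / 4" for \<zeta>
  proof -
    have sub: "x \<in> ball w R - ball w (R / 2)" if "x \<in> ball \<zeta> (R / 4)" for x
    proof -
      have "dist \<zeta> x < R / 4" using that by simp
      then show ?thesis
        using \<zeta> dist_triangle[of w x \<zeta>] dist_triangle[of w \<zeta> x] by (simp add: dist_commute)
    qed
    have "ennreal (cmod (g \<zeta>) powr p) * emeasure lborel (ball \<zeta> (R / 4))
       \<le> (\<integral>\<^sup>+x. ennreal (cmod (g x) powr p) * indicator (ball \<zeta> (R / 4)) x \<partial>lborel)"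
      using sub by (intro powr_norm_submean_disc holomorphic_on_subset[OF g] p) auto
    also have "\<dots> \<le> ?J"
      using sub by (intro nn_integral_mono mult_left_mono) (auto simp: indicator_def)
    finally have "cmod (g \<zeta>) powr p * e \<le> j"
      using e j by (simp add: E ennreal_mult[symmetric])
    then have "cmod (g \<zeta>) powr p \<le> j / e"
      using e by (simp add: field_simps)
    then have "(cmod (g \<zeta>) powr p) powr (1 / p) \<le> (j / e) powr (1 / p)"
      using p by (intro powr_mono2) auto
    then show ?thesis using p by (simp add: powr_powr)
  qed
  have "cmod (g z) \<le> (j / e) powr (1 / p)"
  proof (rule maximum_modulus_frontier[where f = g and \<xi> = z and S = "cball w (3 * R / 4)"])
    have "cball w (3 * R / 4) \<subseteq> ball w R" using R by auto
    then have "g holomorphic_on cball w (3 * R / 4)"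
      using g holomorphic_on_subset by blast
    then show "g holomorphic_on interior (cball w (3 * R / 4))"
        "continuous_on (closure (cball w (3 * R / 4))) g"
      by (auto intro: holomorphic_on_subset holomorphic_on_imp_continuous_on)
    show "z \<in> cball w (3 * R / 4)" using z R by auto
  qed (use circle in \<open>auto simp: frontier_cball sphere_def\<close>)
  then have "cmod (g z) powr p \<le> ((j / e) powr (1 / p)) powr p"
    using p by (intro powr_mono2) auto
  also have "\<dots> = j / e" using p e j by (simp add: powr_powr)
  finally have "cmod (g z) powr p * e \<le> j" using e by (simp add: field_simps)
  then show ?thesis
    unfolding E j(1) using e by (simp add: ennreal_mult[symmetric] ennreal_leI)
qed simp

lemma measurable_weighted_powr_norm:
  fixes g :: "complex \<Rightarrow> complex"
  assumes g: "continuous_on A g" and A: "A \<in> sets borel" and V: "V \<in> borel_measurable borel" and p: "p > 0"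
  shows "(\<lambda>z. ennreal (V z * cmod (g z) powr p) * indicator A z) \<in> borel_measurable borel"
proof -
  have "(\<lambda>z. indicator A z *\<^sub>R cmod (g z) powr p) \<in> borel_measurable borel"
    using p by (intro borel_measurable_continuous_on_indicator A continuous_on_powr' continuous_intros g) auto
  then have "(\<lambda>z. ennreal (V z * (indicator A z *\<^sub>R cmod (g z) powr p))) \<in> borel_measurable borel"
    using V by simp
  also have "(\<lambda>z. ennreal (V z * (indicator A z *\<^sub>R cmod (g z) powr p)))
      = (\<lambda>z. ennreal (V z * cmod (g z) powr p) * indicator A z)"
    by (auto simp: indicator_def)
  finally show ?thesis .
qed

text \<open>The previous bound is uniform over the inner disc, whose area is four times that of a disc of
  radius \<open>R / 4\<close>; this is the factor 4. The oscillation of the weight costs \<open>M / m\<close>.\<close>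

lemma weighted_inner_disc_le_annulus:
  fixes g :: "complex \<Rightarrow> complex" and V :: "complex \<Rightarrow> real" and p R m M :: real
  assumes g: "g holomorphic_on ball w R" and p: "p \<ge> 1" and R: "R > 0"
    and V [measurable]: "V \<in> borel_measurable borel"
    and m: "m > 0" "\<And>z. z \<in> ball w R \<Longrightarrow> m \<le> V z" and M: "\<And>z. z \<in> ball w R \<Longrightarrow> V z \<le> M"
  shows "(\<integral>\<^sup>+z. ennreal (V z * cmod (g z) powr p) * indicator (ball w (R / 2)) z \<partial>lborel)
       \<le> ennreal (4 * M / m) *
          (\<integral>\<^sup>+z. ennreal (V z * cmod (g z) powr p) * indicator (ball w R - ball w (R / 2)) z \<partial>lborel)"
    (is "?L \<le> _ * ?K")
proof -
  define J where "J = (\<integral>\<^sup>+\<zeta>. ennreal (cmod (g \<zeta>) powr p) * indicator (ball w R - ball w (R / 2)) \<zeta> \<partial>lborel)"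
  have w: "w \<in> ball w R" using R by simp
  have M0: "M > 0" using m(1) m(2)[OF w] M[OF w] by linarith
  define e where "e = pi * (R / 4)\<^sup>2"
  have e: "e > 0" using R by (simp add: e_def)
  have E: "emeasure lborel (ball w (R / 4)) = ennreal e" "emeasure lborel (ball w (R / 2)) = ennreal (4 * e)"
    using R by (simp_all add: e_def emeasure_ball unit_ball_vol_2 power2_eq_square)
  have pt: "ennreal (V z * cmod (g z) powr p) \<le> ennreal (M / e) * J" if z: "z \<in> ball w (R / 2)" for z
  proof -
    have z': "z \<in> ball w R" using z R by auto
    have "ennreal (V z * cmod (g z) powr p) \<le> ennreal (M / e * (cmod (g z) powr p * e))"
      using M[OF z'] e by (intro ennreal_leI) (simp add: mult_right_mono)
    also have "\<dots> = ennreal (M / e) * (ennreal (cmod (g z) powr p) * ennreal e)"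
      using M0 e by (simp add: ennreal_mult[symmetric])
    also have "\<dots> \<le> ennreal (M / e) * J"
      unfolding J_def E(1)[symmetric] by (intro mult_left_mono powr_norm_inner_disc_le_annulus g p R z) simp
    finally show ?thesis .
  qed
  have "?L \<le> (\<integral>\<^sup>+z. (ennreal (M / e) * J) * indicator (ball w (R / 2)) z \<partial>lborel)"
    using pt by (intro nn_integral_mono) (auto simp: indicator_def)
  also have "\<dots> = ennreal (M / e) * ennreal (4 * e) * J"
    by (subst nn_integral_cmult_indicator) (simp_all add: E mult_ac)
  also have "ennreal (M / e) * ennreal (4 * e) = ennreal (4 * M)"
    using M0 e by (simp add: ennreal_mult[symmetric])
  also have "J \<le> ennreal (1 / m) * ?K"
  proof -
    have "J \<le> (\<integral>\<^sup>+z. ennreal (1 / m) * (ennreal (V z * cmod (g z) powr p) * indicator (ball w R - ball w (R / 2)) z) \<partial>lborel)"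
      unfolding J_def
    proof (rule nn_integral_mono)
      fix z
      show "ennreal (cmod (g z) powr p) * indicator (ball w R - ball w (R / 2)) z
         \<le> ennreal (1 / m) * (ennreal (V z * cmod (g z) powr p) * indicator (ball w R - ball w (R / 2)) z)"
      proof (cases "z \<in> ball w R - ball w (R / 2)")
        case True
        then have "m \<le> V z" using m(2) by simp
        then have "m * cmod (g z) powr p \<le> V z * cmod (g z) powr p" by (rule mult_right_mono) simp
        then have "cmod (g z) powr p \<le> 1 / m * (V z * cmod (g z) powr p)"
          using m(1) by (simp add: field_simps)
        with True show ?thesis
          using m(1) \<open>m \<le> V z\<close> by (simp add: ennreal_mult[symmetric] del: times_divide_eq_left)
      qed simp
    qed
    also have "\<dots> = ennreal (1 / m) * ?K"
    proof (rule nn_integral_cmult)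
      have "(\<lambda>z. ennreal (V z * cmod (g z) powr p) * indicator (ball w R - ball w (R / 2)) z) \<in> borel_measurable borel"
        using p by (intro measurable_weighted_powr_norm V
            continuous_on_subset[OF holomorphic_on_imp_continuous_on[OF g]]) auto
      then show "(\<lambda>z. ennreal (V z * cmod (g z) powr p) * indicator (ball w R - ball w (R / 2)) z) \<in> borel_measurable lborel"
        by simp
    qed
    finally show ?thesis .
  qed
  finally have "?L \<le> ennreal (4 * M) * (ennreal (1 / m) * ?K)" by (simp add: mult_left_mono)
  also have "\<dots> = ennreal (4 * M / m) * ?K"
    using M0 m(1) by (simp add: mult.assoc[symmetric] ennreal_mult[symmetric])
  finally show ?thesis .
qed

text \<open>A move by at most half the distance to the unit circle changes that distance by a factor of at
  most 2, and \<open>1 - (cmod z)\<^sup>2\<close> differs from \<open>1 - cmod z\<close> by another factor of at most 2.\<close>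

lemma radial_weight_comparable:
  fixes \<gamma> :: real
  assumes w: "cmod w < 1" and z: "z \<in> ball w ((1 - cmod w) / 2)"
  shows "(1 - cmod w) powr \<gamma> / 4 powr \<bar>\<gamma>\<bar> \<le> (1 - (cmod z)\<^sup>2) powr \<gamma>"
    and "(1 - (cmod z)\<^sup>2) powr \<gamma> \<le> 4 powr \<bar>\<gamma>\<bar> * (1 - cmod w) powr \<gamma>"
proof -
  define \<rho> where "\<rho> = 1 - cmod w"
  have \<rho>: "\<rho> > 0" using w by (simp add: \<rho>_def)
  have d: "cmod (z - w) < \<rho> / 2" using z by (simp add: dist_norm \<rho>_def norm_minus_commute)
  have "cmod z \<le> cmod w + cmod (z - w)" "cmod w \<le> cmod z + cmod (z - w)"
    using norm_triangle_sub[of z w] norm_triangle_sub[of w z] by (auto simp: norm_minus_commute)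
  then have l: "1 - cmod z \<ge> \<rho> / 2" and u: "1 - cmod z \<le> 2 * \<rho>" using d by (auto simp: \<rho>_def)
  define t where "t = 1 - (cmod z)\<^sup>2"
  have t: "t = (1 - cmod z) * (1 + cmod z)" by (simp add: t_def power2_eq_square algebra_simps)
  have "1 - cmod z \<le> t" unfolding t using l \<rho> by (simp add: mult_le_cancel_left1)
  then have t1: "\<rho> / 4 \<le> t" using l \<rho> by linarith
  have "t \<le> 2 * (1 - cmod z)" unfolding t using l \<rho> by (subst mult.commute, intro mult_right_mono) auto
  then have t2: "t \<le> 4 * \<rho>" using u by argo
  have t0: "t > 0" using t1 \<rho> by linarith
  have "\<rho> powr \<gamma> \<le> 4 powr \<bar>\<gamma>\<bar> * t powr \<gamma>" "t powr \<gamma> \<le> 4 powr \<bar>\<gamma>\<bar> * \<rho> powr \<gamma>"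
    using t0 \<rho> t1 t2 by (auto intro!: powr_comparable)
  then show "(1 - cmod w) powr \<gamma> / 4 powr \<bar>\<gamma>\<bar> \<le> (1 - (cmod z)\<^sup>2) powr \<gamma>"
    "(1 - (cmod z)\<^sup>2) powr \<gamma> \<le> 4 powr \<bar>\<gamma>\<bar> * (1 - cmod w) powr \<gamma>"
    by (auto simp: t_def \<rho>_def field_simps)
qed

section \<open>A Forelli--Rudin estimate\<close>

text \<open>The integrand is at most \<open>u powr b * a powr (- p)\<close>, used for \<open>u \<le> a\<close>, and at most
  \<open>u powr (b - p)\<close>, used for \<open>u \<ge> a\<close>.\<close>

lemma nn_integral_powr_half_line:
  fixes a b p :: real
  assumes a: "a > 0" and b: "b > -1" and p: "p > b + 1"
  shows "(\<integral>\<^sup>+u. ennreal (u powr b * (a + u) powr (- p)) * indicator {0<..} u \<partial>lborel)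
       \<le> ennreal ((1 / (b + 1) + 1 / (p - b - 1)) * a powr (b + 1 - p))"
proof -
  have p0: "p > 0" using b p by simp
  have "ennreal (u powr b * (a + u) powr (- p)) * indicator {0<..} u
      \<le> ennreal (a powr (- p)) * (ennreal (u powr b) * indicator {0..a} u)
        + ennreal (u powr (b - p)) * indicator {a..} u" for u
  proof (cases "u > 0")
    case True
    have "(a + u) powr (- p) \<le> a powr (- p)" "(a + u) powr (- p) \<le> u powr (- p)"
      using True a p0 by (auto intro!: powr_mono2')
    then have "u powr b * (a + u) powr (- p) \<le> a powr (- p) * u powr b"
      "u powr b * (a + u) powr (- p) \<le> u powr b * u powr (- p)"
      by (auto simp: mult.commute mult_right_mono mult_left_mono)
    moreover have "u powr b * u powr (- p) = u powr (b - p)"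
      by (simp add: powr_add[symmetric])
    ultimately show ?thesis using True
      by (cases "u \<le> a") (auto simp: indicator_def ennreal_mult[symmetric] ennreal_leI intro: add_increasing2)
  qed simp
  then have "(\<integral>\<^sup>+u. ennreal (u powr b * (a + u) powr (- p)) * indicator {0<..} u \<partial>lborel)
      \<le> (\<integral>\<^sup>+u. ennreal (a powr (- p)) * (ennreal (u powr b) * indicator {0..a} u)
        + ennreal (u powr (b - p)) * indicator {a..} u \<partial>lborel)"
    by (intro nn_integral_mono)
  also have "\<dots> = ennreal (a powr (- p)) * (\<integral>\<^sup>+u. ennreal (u powr b) * indicator {0..a} u \<partial>lborel)
        + (\<integral>\<^sup>+u. ennreal (u powr (b - p)) * indicator {a..} u \<partial>lborel)"
    by (simp add: nn_integral_add nn_integral_cmult)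
  also have "(\<integral>\<^sup>+u. ennreal (u powr b) * indicator {0..a} u \<partial>lborel) = ennreal (a powr (b + 1) / (b + 1))"
    using a b by (intro nn_integral_has_integral_lebesgue' has_integral_powr_from_0) auto
  also have "(\<integral>\<^sup>+u. ennreal (u powr (b - p)) * indicator {a..} u \<partial>lborel)
      = ennreal (- (a powr (b - p + 1)) / (b - p + 1))"
    using a p by (intro nn_integral_has_integral_lebesgue' has_integral_powr_to_inf) auto
  also have "- (a powr (b - p + 1)) / (b - p + 1) = 1 / (p - b - 1) * a powr (b + 1 - p)"
  proof -
    have e: "b - p + 1 = b + 1 - p" by simp
    have "- (a powr (b + 1 - p)) / (b + 1 - p) = a powr (b + 1 - p) / - (b + 1 - p)"
      by (metis minus_divide_left minus_divide_right)
    also have "- (b + 1 - p) = p - b - 1" by simp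
    finally show ?thesis unfolding e by simp
  qed
  also have "ennreal (a powr (- p)) * ennreal (a powr (b + 1) / (b + 1)) = ennreal (1 / (b + 1) * a powr (b + 1 - p))"
    using b by (simp add: ennreal_mult[symmetric] powr_add[symmetric])
  also have "ennreal (1 / (b + 1) * a powr (b + 1 - p)) + ennreal (1 / (p - b - 1) * a powr (b + 1 - p))
      = ennreal ((1 / (b + 1) + 1 / (p - b - 1)) * a powr (b + 1 - p))"
    using b p by (subst ennreal_plus[symmetric]) (auto simp: distrib_right)
  finally show ?thesis .
qed

lemma nn_integral_powr_abs_shift:
  fixes d q t0 :: real
  assumes d: "d > 0" and q: "q < -1"
  shows "(\<integral>\<^sup>+t. ennreal ((d + \<bar>t - t0\<bar>) powr q) \<partial>lborel) \<le> ennreal (2 / (- q - 1) * d powr (q + 1))"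
proof -
  define k where "k = (\<lambda>v::real. ennreal (v powr q) * indicator {d..} v)"
  have [measurable]: "k \<in> borel_measurable borel" unfolding k_def by measurable
  have "(\<integral>\<^sup>+v. k v \<partial>lborel) = ennreal (- (d powr (q + 1)) / (q + 1))"
    unfolding k_def using d q by (intro nn_integral_has_integral_lebesgue' has_integral_powr_to_inf) auto
  also have "- (d powr (q + 1)) / (q + 1) = 1 / (- q - 1) * d powr (q + 1)"
  proof -
    have "- (d powr (q + 1)) / (q + 1) = d powr (q + 1) / - (q + 1)"
      by (metis minus_divide_left minus_divide_right)
    then show ?thesis by simp
  qed
  finally have k: "(\<integral>\<^sup>+v. k v \<partial>lborel) = ennreal (1 / (- q - 1) * d powr (q + 1))" .
  have "(\<integral>\<^sup>+t. ennreal ((d + \<bar>t - t0\<bar>) powr q) \<partial>lborel)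
      \<le> (\<integral>\<^sup>+t. k ((d - t0) + 1 * t) + k ((d + t0) + (-1) * t) \<partial>lborel)"
    by (intro nn_integral_mono) (auto simp: k_def indicator_def abs_if algebra_simps)
  also have "\<dots> = (\<integral>\<^sup>+v. k v \<partial>lborel) + (\<integral>\<^sup>+v. k v \<partial>lborel)"
    using nn_integral_real_affine[of k 1 "d - t0"] nn_integral_real_affine[of k "-1" "d + t0"]
    by (subst nn_integral_add) auto
  also have "\<dots> = ennreal (2 / (- q - 1) * d powr (q + 1))"
    using q by (simp add: k ennreal_plus[symmetric] del: ennreal_plus)
  finally show ?thesis .
qed

text \<open>Comparable on the disc to \<open>cmod (1 - cnj w * z)\<close>, the denominator of the Bergman kernels, but
  split into terms that can be estimated separately.\<close>

definition disc_gauge :: "complex \<Rightarrow> complex \<Rightarrow> real" where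
  "disc_gauge z w = (1 - cmod z) + (1 - cmod w) + cmod (z - w)"

lemma disc_gauge_commute: "disc_gauge z w = disc_gauge w z"
  by (simp add: disc_gauge_def norm_minus_commute)

lemma disc_gauge_rotate: "cmod \<omega> = 1 \<Longrightarrow> disc_gauge (\<omega> * z) (\<omega> * w) = disc_gauge z w"
  by (simp add: disc_gauge_def norm_mult flip: right_diff_distrib)

lemma disc_gauge_pos: "z \<in> unit_disc \<Longrightarrow> w \<in> unit_disc \<Longrightarrow> disc_gauge z w > 0"
  by (simp add: disc_gauge_def add_pos_nonneg)

lemma measurable_disc_gauge [measurable (raw)]:
  assumes "f \<in> borel_measurable M" "g \<in> borel_measurable M"
  shows "(\<lambda>x. disc_gauge (f x) (g x)) \<in> borel_measurable M"
  using assms unfolding disc_gauge_def by measurable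

text \<open>In the sector, \<open>y\<^sup>2 < 1/2\<close>, so the circle meets the horizontal line at height \<open>y\<close> transversally
  in the point with abscissa \<open>sqrt (1 - y\<^sup>2)\<close>. Hence the horizontal distance \<open>u\<close> to the circle is comparable
  to the radial distance, and the weight and the gauge are controlled by powers of quantities
  linear in \<open>u\<close>.\<close>

lemma sector_slice_bound:
  fixes b p :: real
  assumes b: "b > -1" and p: "p > b + 1" and z: "z \<in> unit_disc"
    and sec: "\<bar>y\<bar> \<le> x" and w: "Complex x y \<in> unit_disc"
  defines "u \<equiv> sqrt (1 - y\<^sup>2) - x"
  shows "u > 0"
    and "(1 - (cmod (Complex x y))\<^sup>2) powr b * disc_gauge z (Complex x y) powr (- p)
        \<le> 2 powr \<bar>b\<bar> * 4 powr p * (u powr b * ((1 - cmod z) + \<bar>y - Im z\<bar> + u) powr (- p))"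
proof -
  define w where "w = Complex x y"
  define B where "B = sqrt (1 - y\<^sup>2)"
  have w1: "(cmod w)\<^sup>2 = x\<^sup>2 + y\<^sup>2" by (simp add: w_def cmod_power2)
  have cw: "cmod w < 1" using w by (simp add: w_def)
  have "(cmod w)\<^sup>2 < 1" using cw by (simp add: power_less_one_iff)
  then have xy: "x\<^sup>2 + y\<^sup>2 < 1" using w1 by simp
  have x0: "x \<ge> 0" using sec by linarith
  have yx: "y\<^sup>2 \<le> x\<^sup>2" using sec by (simp add: abs_le_square_iff[symmetric] x0)
  have y2: "y\<^sup>2 < 1 / 2" using xy yx by linarith
  have B2: "B\<^sup>2 = 1 - y\<^sup>2" using y2 by (simp add: B_def)
  have B0: "B \<ge> 0" using y2 by (simp add: B_def)
  have "(1 / 2)\<^sup>2 \<le> B\<^sup>2" using y2 unfolding B2 by (simp add: power2_eq_square)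
  then have Bl: "B \<ge> 1 / 2" using B0 power2_le_imp_le by blast
  have "B\<^sup>2 \<le> 1\<^sup>2" unfolding B2 by simp
  then have Bu: "B \<le> 1" using power2_le_imp_le[of B 1] by simp
  have "x\<^sup>2 < B\<^sup>2" using xy B2 by simp
  then have xB: "x < B" using B0 power2_less_imp_less by blast
  have uB: "u = B - x" by (simp add: u_def B_def)
  then show u: "u > 0" using xB by simp
  have fac: "1 - (cmod w)\<^sup>2 = u * (B + x)"
    unfolding w1 uB using B2 by (simp add: power2_eq_square algebra_simps)
  have Bx: "1 / 2 \<le> B + x" "B + x \<le> 2" using Bl Bu x0 xB by auto
  have low: "u / 2 \<le> 1 - (cmod w)\<^sup>2" and up: "1 - (cmod w)\<^sup>2 \<le> 2 * u"
    unfolding fac using mult_left_mono[OF Bx(1), of u] mult_left_mono[OF Bx(2), of u] u by auto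
  have pos: "1 - (cmod w)\<^sup>2 > 0" using low u by linarith
  have 1: "(1 - (cmod w)\<^sup>2) powr b \<le> 2 powr \<bar>b\<bar> * u powr b"
    using pos u up low by (intro powr_comparable) auto
  have "1 - (cmod w)\<^sup>2 = (1 - cmod w) * (1 + cmod w)" by (simp add: power2_eq_square algebra_simps)
  also have "\<dots> \<le> (1 - cmod w) * 2" using cw by (intro mult_left_mono) auto
  finally have "u / 4 \<le> 1 - cmod w" using low by argo
  moreover have "\<bar>y - Im z\<bar> \<le> cmod (z - w)"
    using abs_Im_le_cmod[of "z - w"] by (simp add: w_def abs_minus_commute)
  ultimately have g: "((1 - cmod z) + \<bar>y - Im z\<bar> + u) / 4 \<le> disc_gauge z w"
    using z by (simp add: disc_gauge_def)
  have s: "(1 - cmod z) + \<bar>y - Im z\<bar> + u > 0" using z u by (simp add: add_pos_nonneg)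
  have "disc_gauge z w powr (- p) \<le> (((1 - cmod z) + \<bar>y - Im z\<bar> + u) / 4) powr (- p)"
    using g s b p by (intro powr_mono2') auto
  also have "\<dots> = 4 powr p * ((1 - cmod z) + \<bar>y - Im z\<bar> + u) powr (- p)"
    using s by (simp add: powr_divide powr_minus field_simps)
  finally have 2: "disc_gauge z w powr (- p) \<le> 4 powr p * ((1 - cmod z) + \<bar>y - Im z\<bar> + u) powr (- p)" .
  have "(1 - (cmod w)\<^sup>2) powr b * disc_gauge z w powr (- p)
      \<le> (2 powr \<bar>b\<bar> * u powr b) * (4 powr p * ((1 - cmod z) + \<bar>y - Im z\<bar> + u) powr (- p))"
    using 1 2 by (intro mult_mono) auto
  then show "(1 - (cmod (Complex x y))\<^sup>2) powr b * disc_gauge z (Complex x y) powr (- p)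
        \<le> 2 powr \<bar>b\<bar> * 4 powr p * (u powr b * ((1 - cmod z) + \<bar>y - Im z\<bar> + u) powr (- p))"
    by (simp add: w_def mult_ac)
qed

text \<open>Each horizontal slice is a one-dimensional integral over \<open>u\<close>, which produces
  \<open>(1 - cmod z + \<bar>y - Im z\<bar>) powr (b + 1 - p)\<close>; the integral over \<open>y\<close> raises the exponent by one more.\<close>

lemma sector_gauge_integral:
  fixes b p :: real
  assumes b: "b > -1" and p: "p > b + 2"
  obtains C where "C > 0" and "\<And>z. z \<in> unit_disc \<Longrightarrow>
    (\<integral>\<^sup>+w. ennreal ((1 - (cmod w)\<^sup>2) powr b * disc_gauge z w powr (- p))
        * indicator {w \<in> unit_disc. \<bar>Im w\<bar> \<le> Re w} w \<partial>lborel)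
      \<le> ennreal (C * (1 - cmod z) powr (b + 2 - p))"
proof
  define c1 where "c1 = 2 powr \<bar>b\<bar> * 4 powr p"
  define c2 where "c2 = 1 / (b + 1) + 1 / (p - b - 1)"
  define c3 where "c3 = 2 / (p - b - 2)"
  have c: "c1 > 0" "c2 > 0" "c3 > 0"
    using b p by (auto simp: c1_def c2_def c3_def intro!: add_pos_pos mult_pos_pos)
  show "c1 * c2 * c3 > 0" using c by simp
  fix z assume z: "z \<in> unit_disc"
  let ?S = "{w \<in> unit_disc. \<bar>Im w\<bar> \<le> Re w}"
  let ?h = "\<lambda>w. ennreal ((1 - (cmod w)\<^sup>2) powr b * disc_gauge z w powr (- p)) * indicator ?S w"
  have S [measurable]: "?S \<in> sets borel" by measurable
  define d where "d = 1 - cmod z"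
  have d: "d > 0" using z by (simp add: d_def)
  have slice: "(\<integral>\<^sup>+x. ?h (Complex x y) \<partial>lborel) \<le> ennreal (c1 * c2) * ennreal ((d + \<bar>y - Im z\<bar>) powr (b + 1 - p))" for y
  proof -
    define a where "a = d + \<bar>y - Im z\<bar>"
    have a: "a > 0" using d by (simp add: a_def)
    define k where "k = (\<lambda>u. ennreal (u powr b * (a + u) powr (- p)) * indicator {0<..} u)"
    have [measurable]: "k \<in> borel_measurable borel" unfolding k_def by measurable
    have "?h (Complex x y) \<le> ennreal c1 * k (sqrt (1 - y\<^sup>2) + (-1) * x)" for x
    proof (cases "Complex x y \<in> ?S")
      case True
      then have *: "\<bar>y\<bar> \<le> x" "Complex x y \<in> unit_disc" by auto
      have p': "p > b + 1" using p by simp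
      note sl = sector_slice_bound[OF b p' z *]
      have "?h (Complex x y) = ennreal ((1 - (cmod (Complex x y))\<^sup>2) powr b * disc_gauge z (Complex x y) powr (- p))"
        using True by simp
      also have "\<dots> \<le> ennreal (c1 * ((sqrt (1 - y\<^sup>2) - x) powr b * (a + (sqrt (1 - y\<^sup>2) - x)) powr (- p)))"
        using sl(2) by (intro ennreal_leI) (simp only: c1_def a_def d_def)
      also have "\<dots> = ennreal c1 * k (sqrt (1 - y\<^sup>2) + (-1) * x)"
        using sl(1) c by (simp add: k_def ennreal_mult)
      finally show ?thesis .
    qed simp
    then have "(\<integral>\<^sup>+x. ?h (Complex x y) \<partial>lborel) \<le> (\<integral>\<^sup>+x. ennreal c1 * k (sqrt (1 - y\<^sup>2) + (-1) * x) \<partial>lborel)"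
      by (rule nn_integral_mono)
    also have "\<dots> = ennreal c1 * (\<integral>\<^sup>+u. k u \<partial>lborel)"
      using nn_integral_real_affine[of k "-1" "sqrt (1 - y\<^sup>2)"] by (subst nn_integral_cmult) auto
    also have "(\<integral>\<^sup>+u. k u \<partial>lborel) \<le> ennreal (c2 * a powr (b + 1 - p))"
      unfolding k_def c2_def using a b p by (intro nn_integral_powr_half_line) auto
    also have "ennreal c1 * ennreal (c2 * a powr (b + 1 - p)) = ennreal (c1 * c2) * ennreal (a powr (b + 1 - p))"
      using c by (simp add: ennreal_mult[symmetric] mult.assoc)
    finally show ?thesis by (simp add: a_def mult_left_mono)
  qed
  have "(\<integral>\<^sup>+w. ?h w \<partial>lborel) = (\<integral>\<^sup>+y. \<integral>\<^sup>+x. ?h (Complex x y) \<partial>lborel \<partial>lborel)"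
    by (rule nn_integral_complex_iterated(1)) measurable
  also have "\<dots> \<le> (\<integral>\<^sup>+y. ennreal (c1 * c2) * ennreal ((d + \<bar>y - Im z\<bar>) powr (b + 1 - p)) \<partial>lborel)"
    by (intro nn_integral_mono slice)
  also have "\<dots> = ennreal (c1 * c2) * (\<integral>\<^sup>+y. ennreal ((d + \<bar>y - Im z\<bar>) powr (b + 1 - p)) \<partial>lborel)"
    by (rule nn_integral_cmult) measurable
  also have "\<dots> \<le> ennreal (c1 * c2) * ennreal (2 / (- (b + 1 - p) - 1) * d powr ((b + 1 - p) + 1))"
    using d p by (intro mult_left_mono nn_integral_powr_abs_shift) auto
  also have "- (b + 1 - p) - 1 = p - b - 2" by simp
  also have "(b + 1 - p) + 1 = b + 2 - p" by simp
  also have "ennreal (c1 * c2) * ennreal (2 / (p - b - 2) * d powr (b + 2 - p)) = ennreal (c1 * c2 * c3 * d powr (b + 2 - p))"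
    using c p unfolding c3_def by (subst ennreal_mult[symmetric]) (auto simp: mult.assoc)
  finally show "(\<integral>\<^sup>+w. ?h w \<partial>lborel) \<le> ennreal (c1 * c2 * c3 * (1 - cmod z) powr (b + 2 - p))"
    by (simp add: d_def)
qed

text \<open>A Forelli--Rudin estimate. The disc is the union of four sectors, which quarter turns map to
  the sector treated above. The gauge is invariant under rotation of both arguments, so a rotation
  of \<open>w\<close> is traded for one of \<open>z\<close>, which does not change \<open>cmod z\<close>.\<close>

lemma disc_gauge_integral:
  fixes b p :: real
  assumes b: "b > -1" and p: "p > b + 2"
  obtains C where "C > 0" and "\<And>z. z \<in> unit_disc \<Longrightarrow>
    (\<integral>\<^sup>+w. ennreal ((1 - (cmod w)\<^sup>2) powr b * disc_gauge z w powr (- p)) * indicator unit_disc w \<partial>lborel)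
      \<le> ennreal (C * (1 - (cmod z)\<^sup>2) powr (b + 2 - p))"
proof -
  let ?S = "{w \<in> unit_disc. \<bar>Im w\<bar> \<le> Re w}"
  let ?H = "\<lambda>z w. ennreal ((1 - (cmod w)\<^sup>2) powr b * disc_gauge z w powr (- p))"
  have S [measurable]: "?S \<in> sets borel" by measurable
  from sector_gauge_integral[OF b p] obtain C where C: "C > 0" and
    sec: "\<And>z. z \<in> unit_disc \<Longrightarrow> (\<integral>\<^sup>+w. ?H z w * indicator ?S w \<partial>lborel) \<le> ennreal (C * (1 - cmod z) powr (b + 2 - p))"
    by blast
  define C' where "C' = 4 * C * 2 powr (p - b - 2)"
  show thesis
  proof
    show "C' > 0" using C by (simp add: C'_def)
    fix z assume z: "z \<in> unit_disc"
    define d where "d = 1 - cmod z"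
    have rot: "(\<integral>\<^sup>+w. ?H z w * indicator ?S (\<i> ^ k * w) \<partial>lborel) \<le> ennreal (C * d powr (b + 2 - p))" for k
    proof -
      have n: "cmod (\<i> ^ k) = 1" by (simp add: norm_power)
      have "(\<integral>\<^sup>+w. ?H z w * indicator ?S (\<i> ^ k * w) \<partial>lborel)
          = (\<integral>\<^sup>+w. (\<lambda>w. ?H (\<i> ^ k * z) w * indicator ?S w) (\<i> ^ k * w) \<partial>lborel)"
        by (simp add: disc_gauge_rotate[OF n] norm_mult n)
      also have "\<dots> = (\<integral>\<^sup>+w. ?H (\<i> ^ k * z) w * indicator ?S w \<partial>lborel)"
        by (rule nn_integral_rotation[OF _ n]) measurable
      also have "\<dots> \<le> ennreal (C * (1 - cmod (\<i> ^ k * z)) powr (b + 2 - p))"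
        using z by (intro sec) (simp add: norm_mult n)
      finally show ?thesis by (simp add: norm_mult n d_def)
    qed
    have cover: "\<exists>k<4. \<i> ^ k * w \<in> ?S" if "w \<in> unit_disc" for w
    proof -
      have "\<bar>Im w\<bar> \<le> Re w \<or> \<bar>Re w\<bar> \<le> - Im w \<or> \<bar>Im w\<bar> \<le> - Re w \<or> \<bar>Re w\<bar> \<le> Im w" by linarith
      then show ?thesis
      proof (elim disjE)
        assume "\<bar>Im w\<bar> \<le> Re w"
        then show ?thesis using that by (intro exI[of _ 0]) auto
      next
        assume "\<bar>Re w\<bar> \<le> - Im w"
        then show ?thesis using that by (intro exI[of _ 1]) (auto simp: norm_mult)
      next
        assume "\<bar>Im w\<bar> \<le> - Re w"
        then show ?thesis using that by (intro exI[of _ 2]) (auto simp: norm_mult)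
      next
        assume "\<bar>Re w\<bar> \<le> Im w"
        then show ?thesis using that by (intro exI[of _ 3]) (auto simp: norm_mult power3_eq_cube)
      qed
    qed
    have "?H z w * indicator unit_disc w \<le> (\<Sum>k<4. ?H z w * indicator ?S (\<i> ^ k * w))" for w
    proof (cases "w \<in> unit_disc")
      case True
      then obtain k where k: "k < 4" "\<i> ^ k * w \<in> ?S" using cover by blast
      have "?H z w * indicator unit_disc w = ?H z w * indicator ?S (\<i> ^ k * w)"
        using True k(2) by (simp only: indicator_simps)
      also have "\<dots> \<le> (\<Sum>k<4. ?H z w * indicator ?S (\<i> ^ k * w))"
        using k by (intro member_le_sum) auto
      finally show ?thesis .
    qed simp
    then have "(\<integral>\<^sup>+w. ?H z w * indicator unit_disc w \<partial>lborel)
       \<le> (\<integral>\<^sup>+w. (\<Sum>k<4. ?H z w * indicator ?S (\<i> ^ k * w)) \<partial>lborel)"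
      by (intro nn_integral_mono)
    also have "\<dots> = (\<Sum>k<4. \<integral>\<^sup>+w. ?H z w * indicator ?S (\<i> ^ k * w) \<partial>lborel)"
      by (rule nn_integral_sum) measurable
    also have "\<dots> \<le> (\<Sum>k<4::nat. ennreal (C * d powr (b + 2 - p)))"
      by (intro sum_mono rot)
    also have "\<dots> = ennreal (4 * C * d powr (b + 2 - p))"
      using C by (simp add: ennreal_mult mult.assoc)
    also have "\<dots> \<le> ennreal (C' * (1 - (cmod z)\<^sup>2) powr (b + 2 - p))"
    proof (intro ennreal_leI)
      define t where "t = 1 - (cmod z)\<^sup>2"
      have z1: "cmod z < 1" using z by simp
      have t: "t = (1 - cmod z) * (1 + cmod z)" by (simp add: t_def power2_eq_square algebra_simps)
      have t0: "t > 0" unfolding t using z1 by (intro mult_pos_pos) (auto intro: add_pos_nonneg)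
      have "t \<le> d * 2" unfolding t d_def using z1 by (intro mult_left_mono) auto
      then have "d powr (b + 2 - p) \<le> (t / 2) powr (b + 2 - p)"
        using p t0 by (intro powr_mono2') auto
      also have "\<dots> = 2 powr (p - b - 2) * t powr (b + 2 - p)"
      proof -
        have "(2::real) powr (p - b - 2) = 1 / 2 powr (b + 2 - p)"
          using powr_minus_divide[of "2::real" "b + 2 - p"] by (simp add: algebra_simps)
        then show ?thesis using t0 by (simp add: powr_divide)
      qed
      finally have "4 * C * d powr (b + 2 - p) \<le> 4 * C * (2 powr (p - b - 2) * t powr (b + 2 - p))"
        using C by (intro mult_left_mono) auto
      then show "4 * C * d powr (b + 2 - p) \<le> C' * (1 - (cmod z)\<^sup>2) powr (b + 2 - p)"
        by (simp add: C'_def t_def mult.assoc)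
    qed
    finally show "(\<integral>\<^sup>+w. ?H z w * indicator unit_disc w \<partial>lborel) \<le> ennreal (C' * (1 - (cmod z)\<^sup>2) powr (b + 2 - p))" .
  qed
qed

section \<open>Holomorphy of the symmetric lifting\<close>

text \<open>Let \<open>g\<close> be \<open>f\<close> minus the linear and the quadratic terms of its Taylor expansion at \<open>a\<close>. The difference quotient
  of \<open>(z - a)\<^sup>2\<close> is \<open>(z - a) + (w - a)\<close>, so the quantity to be estimated is exactly the difference
  quotient of \<open>g\<close>, or its derivative if \<open>z = w\<close>. It is bounded by the supremum of \<open>cmod g'\<close> near \<open>a\<close>, and \<open>g'\<close> is \<open>o(z - a)\<close> because it is the
  remainder in the definition of the derivative of \<open>deriv f\<close>.\<close>

lemma symmetric_lifting_diag_bound: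
  assumes f: "f holomorphic_on ball a r" and e: "e > 0" and r: "r > 0"
  obtains d where "d > 0" and "\<And>z w. cmod (z - a) < d \<Longrightarrow> cmod (w - a) < d \<Longrightarrow>
    cmod (symmetric_lifting f (z, w) - deriv f a - deriv (deriv f) a / 2 * ((z - a) + (w - a)))
      \<le> e * max (cmod (z - a)) (cmod (w - a))"
proof -
  define g where "g = (\<lambda>z. f z - deriv f a * (z - a) - deriv (deriv f) a / 2 * (z - a)\<^sup>2)"
  define g' where "g' = (\<lambda>z. deriv f z - deriv f a - deriv (deriv f) a * (z - a))"
  have a: "a \<in> ball a r" using r by simp
  have df: "(f has_field_derivative deriv f z) (at z)" if "z \<in> ball a r" for z
    using f that by (intro holomorphic_derivI[of f "ball a r"]) auto
  have dg: "(g has_field_derivative g' z) (at z)" if "z \<in> ball a r" for z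
    unfolding g_def g'_def
    by (rule derivative_eq_intros df[OF that] refl | simp)+
  have "(deriv f has_field_derivative deriv (deriv f) a) (at a)"
    using holomorphic_deriv[OF f] a by (intro holomorphic_derivI[of _ "ball a r"]) auto
  then have "(deriv f has_derivative (\<lambda>h. deriv (deriv f) a * h)) (at a)"
    by (simp add: has_field_derivative_def)
  then obtain d0 where d0: "d0 > 0" "\<And>z. cmod (z - a) < d0 \<Longrightarrow> cmod (g' z) \<le> e * cmod (z - a)"
    using e unfolding has_derivative_at_alt g'_def by blast
  define d where "d = min d0 r"
  have mem: "z \<in> ball a r" if "cmod (z - a) < d" for z
    using that by (auto simp: d_def dist_norm norm_minus_commute)
  show thesis
  proof
    show "d > 0" using d0 r by (simp add: d_def)
    fix z w assume z: "cmod (z - a) < d" and w: "cmod (w - a) < d"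
    define m where "m = max (cmod (z - a)) (cmod (w - a))"
    have m: "m < d" using z w by (simp add: m_def)
    have g'm: "cmod (g' x) \<le> e * m" if "x \<in> cball a m" for x
    proof -
      have x: "cmod (x - a) \<le> m" using that by (simp add: dist_norm norm_minus_commute)
      then have "cmod (g' x) \<le> e * cmod (x - a)" using m by (intro d0) (simp add: d_def)
      also have "\<dots> \<le> e * m" using x e by (intro mult_left_mono) auto
      finally show ?thesis .
    qed
    have zm: "z \<in> cball a m" "w \<in> cball a m" by (auto simp: m_def dist_norm norm_minus_commute)
    show "cmod (symmetric_lifting f (z, w) - deriv f a - deriv (deriv f) a / 2 * ((z - a) + (w - a))) \<le> e * m"
    proof (cases "z = w")
      case True
      then have "symmetric_lifting f (z, w) - deriv f a - deriv (deriv f) a / 2 * ((z - a) + (w - a)) = g' z"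
        by (simp add: symmetric_lifting_def g'_def)
      then show ?thesis using g'm[OF zm(1)] by simp
    next
      case False
      then have nz: "z - w \<noteq> 0" by simp
      have "cmod (g z - g w) \<le> e * m * cmod (z - w)"
      proof (rule field_differentiable_bound[where S = "cball a m"])
        fix x assume x: "x \<in> cball a m"
        then have "cmod (x - a) < d" using m by (simp add: dist_norm norm_minus_commute)
        from dg[OF mem[OF this]] show "(g has_field_derivative g' x) (at x within cball a m)"
          by (rule has_field_derivative_at_within)
      qed (use g'm zm in auto)
      moreover have "g z - g w = (symmetric_lifting f (z, w) - deriv f a
          - deriv (deriv f) a / 2 * ((z - a) + (w - a))) * (z - w)"
        using False nz by (simp add: symmetric_lifting_def g_def power2_eq_square field_simps)
      ultimately show ?thesis using nz by (simp add: norm_mult)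
    qed
  qed
qed

lemma symmetric_lifting_holomorphic2:
  assumes f: "f holomorphic_on S" and S: "open S"
  shows "symmetric_lifting f holomorphic2_on (S \<times> S)"
  unfolding holomorphic2_on_def
proof (intro ballI)
  fix x assume "x \<in> S \<times> S"
  then obtain a b where x: "x = (a, b)" and a: "a \<in> S" and b: "b \<in> S" by auto
  show "\<exists>c d. (symmetric_lifting f has_derivative (\<lambda>(h, k). c * h + d * k)) (at x)"
  proof (cases "a = b")
    case False
    have fst: "((\<lambda>p. f (fst p)) has_derivative (\<lambda>h. deriv f a * fst h)) (at (a, b))"
      using holomorphic_derivI[OF f S a] unfolding has_field_derivative_def
      by (intro has_derivative_compose[OF has_derivative_fst[OF has_derivative_ident]]) simp
    have snd: "((\<lambda>p. f (snd p)) has_derivative (\<lambda>h. deriv f b * snd h)) (at (a, b))"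
      using holomorphic_derivI[OF f S b] unfolding has_field_derivative_def
      by (intro has_derivative_compose[OF has_derivative_snd[OF has_derivative_ident]]) simp
    have diff: "((\<lambda>p. fst p - snd p) has_derivative (\<lambda>h. fst h - snd h)) (at (a, b :: complex))"
      by (intro derivative_intros)
    have "((\<lambda>p. (f (fst p) - f (snd p)) / (fst p - snd p)) has_derivative
        (\<lambda>h. - (f a - f b) * (inverse (a - b) * (fst h - snd h) * inverse (a - b))
             + (deriv f a * fst h - deriv f b * snd h) / (a - b))) (at (a, b))"
      using has_derivative_divide[OF has_derivative_diff[OF fst snd] diff] False by simp
    moreover have "(\<lambda>h. - (f a - f b) * (inverse (a - b) * (fst h - snd h) * inverse (a - b))
             + (deriv f a * fst h - deriv f b * snd h) / (a - b))
        = (\<lambda>(h, k). (deriv f a / (a - b) - (f a - f b) / (a - b)\<^sup>2) * h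
            + ((f a - f b) / (a - b)\<^sup>2 - deriv f b / (a - b)) * k)"
      by (simp only: power2_eq_square divide_inverse inverse_mult_distrib) (simp add: fun_eq_iff algebra_simps)
    ultimately have D: "((\<lambda>p. (f (fst p) - f (snd p)) / (fst p - snd p)) has_derivative
        (\<lambda>(h, k). (deriv f a / (a - b) - (f a - f b) / (a - b)\<^sup>2) * h
            + ((f a - f b) / (a - b)\<^sup>2 - deriv f b / (a - b)) * k)) (at (a, b))"
      by simp
    \<comment> \<open>The quotient formula holds only off the diagonal, which is an open set.\<close>
    have op: "open {p :: complex \<times> complex. fst p \<noteq> snd p}"
      by (intro open_Collect_neq continuous_intros)
    have "(symmetric_lifting f has_derivative
        (\<lambda>(h, k). (deriv f a / (a - b) - (f a - f b) / (a - b)\<^sup>2) * h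
            + ((f a - f b) / (a - b)\<^sup>2 - deriv f b / (a - b)) * k)) (at (a, b))"
      by (rule has_derivative_transform_within_open[OF D op])
         (use False in \<open>auto simp: symmetric_lifting_def\<close>)
    then show ?thesis unfolding x by blast
  next
    case True
    obtain r where r: "r > 0" "ball a r \<subseteq> S" using S a openE by blast
    have fr: "f holomorphic_on ball a r" using f r(2) by (rule holomorphic_on_subset)
    define c where "c = deriv (deriv f) a / 2"
    have "(symmetric_lifting f has_derivative (\<lambda>(h, k). c * h + c * k)) (at (a, a))"
      unfolding has_derivative_at_alt
    proof (intro conjI allI impI)
      have "bounded_linear (\<lambda>p. c * fst p + c * snd p)"
        by (intro bounded_linear_add bounded_linear_compose[OF bounded_linear_mult_right] bounded_linear_fst bounded_linear_snd)
      then show "bounded_linear (\<lambda>(h, k). c * h + c * k)" by (simp add: split_beta')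
    next
      fix e :: real assume e: "e > 0"
      obtain d where d: "d > 0" "\<And>z w. cmod (z - a) < d \<Longrightarrow> cmod (w - a) < d \<Longrightarrow>
          cmod (symmetric_lifting f (z, w) - deriv f a - deriv (deriv f) a / 2 * ((z - a) + (w - a)))
            \<le> e * max (cmod (z - a)) (cmod (w - a))"
        using symmetric_lifting_diag_bound[OF fr e r(1)] by blast
      have "norm (symmetric_lifting f y - symmetric_lifting f (a, a) - (case y - (a, a) of (h, k) \<Rightarrow> c * h + c * k))
          \<le> e * norm (y - (a, a))" if y: "norm (y - (a, a)) < d" for y
      proof -
        obtain z w where yz: "y = (z, w)" by (cases y)
        have zn: "cmod (z - a) \<le> norm (y - (a, a))" and wn: "cmod (w - a) \<le> norm (y - (a, a))"
          using norm_fst_le[of "z - a" "w - a"] norm_snd_le[of "w - a" "z - a"] by (auto simp: yz)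
        have "norm (symmetric_lifting f y - symmetric_lifting f (a, a) - (case y - (a, a) of (h, k) \<Rightarrow> c * h + c * k))
            = cmod (symmetric_lifting f (z, w) - deriv f a - deriv (deriv f) a / 2 * ((z - a) + (w - a)))"
        proof -
          have "(case y - (a, a) of (h, k) \<Rightarrow> c * h + c * k) = deriv (deriv f) a / 2 * ((z - a) + (w - a))"
            by (simp add: yz c_def field_simps)
          moreover have "symmetric_lifting f (a, a) = deriv f a" by (simp add: symmetric_lifting_def)
          ultimately show ?thesis by (simp only: yz)
        qed
        also have "\<dots> \<le> e * max (cmod (z - a)) (cmod (w - a))"
          using zn wn y by (intro d) auto
        also have "\<dots> \<le> e * norm (y - (a, a))" using zn wn e by (intro mult_left_mono) auto
        finally show ?thesis .
      qed
      then show "\<exists>d>0. \<forall>y. norm (y - (a, a)) < d \<longrightarrow>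
          norm (symmetric_lifting f y - symmetric_lifting f (a, a) - (case y - (a, a) of (h, k) \<Rightarrow> c * h + c * k))
            \<le> e * norm (y - (a, a))"
        using d(1) by blast
    qed
    then show ?thesis unfolding x using True by blast
  qed
qed

lemma symmetric_lifting_holomorphic_fst:
  assumes "f holomorphic_on S" "open S" "w \<in> S"
  shows "(\<lambda>z. symmetric_lifting f (z, w)) holomorphic_on S"
proof -
  have "(\<lambda>z. if z = w then deriv f w else (f z - f w) / (z - w)) holomorphic_on S"
    using assms by (intro pole_lemma_open)
  moreover have "(\<lambda>z. symmetric_lifting f (z, w)) = (\<lambda>z. if z = w then deriv f w else (f z - f w) / (z - w))"
    by (auto simp: symmetric_lifting_def)
  ultimately show ?thesis by simp
qed

section \<open>Removing the diagonal\<close>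

lemma powr_add_le:
  fixes a b p :: real
  assumes "a \<ge> 0" "b \<ge> 0" "p \<ge> 0"
  shows "(a + b) powr p \<le> 2 powr p * (a powr p + b powr p)"
proof -
  have "(a + b) powr p \<le> (2 * max a b) powr p" using assms by (intro powr_mono2) auto
  also have "\<dots> = 2 powr p * max a b powr p" using assms by (simp add: powr_mult)
  also have "\<dots> \<le> 2 powr p * (a powr p + b powr p)"
    by (intro mult_left_mono) (auto simp: max_def)
  finally show ?thesis .
qed

text \<open>Away from the diagonal \<open>1 - cmod w\<close> is at most \<open>4 * cmod (z - w)\<close>, so \<open>1 - cmod z\<close> is at most
  \<open>5 * cmod (z - w)\<close> and \<open>disc_gauge z w \<le> 10 * cmod (z - w)\<close>. The factor 20 is this 10 times the 2
  from the inequality for the power of a sum.\<close>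

lemma symmetric_lifting_offdiag_le:
  fixes f :: "complex \<Rightarrow> complex" and p :: real
  assumes z: "z \<in> unit_disc" and w: "w \<in> unit_disc" and far: "(1 - cmod w) / 4 \<le> cmod (z - w)" and p: "p > 0"
  shows "cmod (symmetric_lifting f (z, w)) powr p
       \<le> 20 powr p * ((cmod (f z) powr p + cmod (f w) powr p) * disc_gauge z w powr (- p))"
proof -
  have w1: "cmod w < 1" using w by simp
  have zw: "cmod (z - w) > 0" using far w1 by argo
  then have ne: "z \<noteq> w" by auto
  have D: "disc_gauge z w > 0" using z w by (rule disc_gauge_pos)
  have "cmod w \<le> cmod z + cmod (z - w)" 
    using norm_triangle_sub[of w z] by (simp add: norm_minus_commute)
  then have g: "disc_gauge z w / 10 \<le> cmod (z - w)"
    using far unfolding disc_gauge_def by argo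
  have "cmod (symmetric_lifting f (z, w)) = cmod (f z - f w) / cmod (z - w)"
    using ne by (simp add: symmetric_lifting_def norm_divide)
  also have "\<dots> \<le> (cmod (f z) + cmod (f w)) / cmod (z - w)"
    using zw by (intro divide_right_mono norm_triangle_ineq4) auto
  finally have "cmod (symmetric_lifting f (z, w)) powr p \<le> ((cmod (f z) + cmod (f w)) / cmod (z - w)) powr p"
    using p by (intro powr_mono2) auto
  also have "\<dots> = (cmod (f z) + cmod (f w)) powr p * cmod (z - w) powr (- p)"
    using zw by (simp add: powr_divide powr_minus_divide)
  also have "\<dots> \<le> (2 powr p * (cmod (f z) powr p + cmod (f w) powr p)) * (disc_gauge z w / 10) powr (- p)"
    using g D p by (intro mult_mono powr_add_le powr_mono2') auto
  also have "(disc_gauge z w / 10) powr (- p) = 10 powr p * disc_gauge z w powr (- p)"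
    using D by (simp add: powr_divide powr_minus field_simps)
  also have "(2 powr p * (cmod (f z) powr p + cmod (f w) powr p)) * (10 powr p * disc_gauge z w powr (- p))
      = (2 * 10) powr p * ((cmod (f z) powr p + cmod (f w) powr p) * disc_gauge z w powr (- p))"
    by (subst powr_mult) (auto simp: mult_ac)
  finally show ?thesis by simp
qed

text \<open>For fixed \<open>w\<close> the lifting is holomorphic in \<open>z\<close> across \<open>z = w\<close>, so its integral near \<open>w\<close> is
  dominated by its integral over a surrounding annulus. Only the part away from the diagonal
  remains, and there the numerator and the denominator are estimated separately.\<close>

lemma symmetric_lifting_slice_bound:
  fixes f :: "complex \<Rightarrow> complex" and b p :: real
  assumes f: "f holomorphic_on unit_disc" and p: "p \<ge> 1" and w: "w \<in> unit_disc"
  shows "(\<integral>\<^sup>+z. ennreal ((1 - (cmod z)\<^sup>2) powr b * cmod (symmetric_lifting f (z, w)) powr p) * indicator unit_disc z \<partial>lborel)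
      \<le> (\<integral>\<^sup>+z. ennreal ((1 + 4 * 16 powr \<bar>b\<bar>) * 20 powr p) * (ennreal ((1 - (cmod z)\<^sup>2) powr b *
            ((cmod (f z) powr p + cmod (f w) powr p) * disc_gauge z w powr (- p))) * indicator unit_disc z) \<partial>lborel)"
proof -
  define V where "V = (\<lambda>z. (1 - (cmod z)\<^sup>2) powr b)"
  define g where "g = (\<lambda>z. symmetric_lifting f (z, w))"
  define R where "R = (1 - cmod w) / 2"
  define I where "I = (\<lambda>A. \<integral>\<^sup>+z. ennreal (V z * cmod (g z) powr p) * indicator A z \<partial>lborel)"
  let ?far = "unit_disc - ball w (R / 2)"
  have w1: "cmod w < 1" using w by simp
  have R: "R > 0" using w1 by (simp add: R_def)
  have V [measurable]: "V \<in> borel_measurable borel" unfolding V_def by measurable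
  have sub: "ball w R \<subseteq> unit_disc"
  proof
    fix z assume "z \<in> ball w R"
    then have "cmod (z - w) < R" by (simp add: dist_norm norm_minus_commute)
    then show "z \<in> unit_disc" using norm_triangle_sub[of z w] w1 by (simp add: R_def)
  qed
  have g: "g holomorphic_on unit_disc"
    unfolding g_def using f w by (intro symmetric_lifting_holomorphic_fst) auto
  have meas: "(\<lambda>z. ennreal (V z * cmod (g z) powr p) * indicator A z) \<in> borel_measurable lborel"
    if "A \<subseteq> unit_disc" "A \<in> sets borel" for A
    using that p V by (simp, intro measurable_weighted_powr_norm continuous_on_subset[OF holomorphic_on_imp_continuous_on[OF g]]) auto
  define m where "m = (1 - cmod w) powr b / 4 powr \<bar>b\<bar>"
  define M where "M = 4 powr \<bar>b\<bar> * (1 - cmod w) powr b"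
  have m0: "m > 0" using w1 by (simp add: m_def)
  have Mm: "4 * M / m = 4 * 16 powr \<bar>b\<bar>"
    using w1 powr_mult[of 4 4 "\<bar>b\<bar>"] by (simp add: M_def m_def)
  have "I (ball w (R / 2)) \<le> ennreal (4 * M / m) * I (ball w R - ball w (R / 2))"
    unfolding I_def
  proof (rule weighted_inner_disc_le_annulus[OF holomorphic_on_subset[OF g sub] p R V m0])
    fix z assume "z \<in> ball w R"
    then show "m \<le> V z" "V z \<le> M"
      using radial_weight_comparable[OF w1, of z b] unfolding m_def M_def V_def R_def by auto
  qed
  also have "I (ball w R - ball w (R / 2)) \<le> I ?far"
    unfolding I_def using sub by (intro nn_integral_mono mult_left_mono) (auto simp: indicator_def)
  finally have near: "I (ball w (R / 2)) \<le> ennreal (4 * 16 powr \<bar>b\<bar>) * I ?far"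
    unfolding Mm by (simp add: mult_left_mono)
  have "ball w (R / 2) \<subseteq> unit_disc" using sub R by (auto simp: subset_iff)
  then have "I unit_disc = (\<integral>\<^sup>+z. ennreal (V z * cmod (g z) powr p) * indicator (ball w (R / 2)) z
      + ennreal (V z * cmod (g z) powr p) * indicator ?far z \<partial>lborel)"
    unfolding I_def by (intro nn_integral_cong) (auto simp: indicator_def)
  also have "\<dots> = I (ball w (R / 2)) + I ?far"
    unfolding I_def by (intro nn_integral_add meas) (use \<open>ball w (R / 2) \<subseteq> unit_disc\<close> in auto)
  also have "\<dots> \<le> ennreal (4 * 16 powr \<bar>b\<bar>) * I ?far + I ?far"
    using near by (intro add_right_mono)
  also have "\<dots> = ennreal (1 + 4 * 16 powr \<bar>b\<bar>) * I ?far"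
    by (simp add: distrib_right add.commute)
  also have "\<dots> = (\<integral>\<^sup>+z. ennreal (1 + 4 * 16 powr \<bar>b\<bar>) * (ennreal (V z * cmod (g z) powr p) * indicator ?far z) \<partial>lborel)"
    unfolding I_def by (intro nn_integral_cmult[symmetric] meas) auto
  also have "\<dots> \<le> (\<integral>\<^sup>+z. ennreal ((1 + 4 * 16 powr \<bar>b\<bar>) * 20 powr p) * (ennreal (V z *
            ((cmod (f z) powr p + cmod (f w) powr p) * disc_gauge z w powr (- p))) * indicator unit_disc z) \<partial>lborel)"
  proof (rule nn_integral_mono)
    fix z
    let ?T = "(cmod (f z) powr p + cmod (f w) powr p) * disc_gauge z w powr (- p)"
    let ?K = "1 + 4 * 16 powr \<bar>b\<bar> :: real"
    show "ennreal ?K * (ennreal (V z * cmod (g z) powr p) * indicator ?far z)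
        \<le> ennreal (?K * 20 powr p) * (ennreal (V z * ?T) * indicator unit_disc z)"
    proof (cases "z \<in> ?far")
      case True
      then have z: "z \<in> unit_disc" and far: "(1 - cmod w) / 4 \<le> cmod (z - w)"
        by (auto simp: R_def dist_norm norm_minus_commute)
      have V0: "V z \<ge> 0" by (simp add: V_def)
      have "cmod (g z) powr p \<le> 20 powr p * ?T"
        unfolding g_def using z w far p by (intro symmetric_lifting_offdiag_le) auto
      then have "V z * cmod (g z) powr p \<le> V z * (20 powr p * ?T)"
        using V0 by (rule mult_left_mono)
      then have "?K * (V z * cmod (g z) powr p) \<le> ?K * (V z * (20 powr p * ?T))"
        by (rule mult_left_mono) (simp add: add_nonneg_nonneg)
      then have "ennreal (?K * (V z * cmod (g z) powr p)) \<le> ennreal ((?K * 20 powr p) * (V z * ?T))"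
        by (intro ennreal_leI) (simp add: mult_ac)
      also have "\<dots> = ennreal (?K * 20 powr p) * ennreal (V z * ?T)"
        by (rule ennreal_mult) (use V0 in \<open>auto intro!: mult_nonneg_nonneg add_nonneg_nonneg\<close>)
      finally show ?thesis
        using True z V0 by (simp add: ennreal_mult)
    qed simp
  qed
  finally show ?thesis by (simp add: I_def V_def g_def)
qed

section \<open>Boundedness on weighted Bergman spaces\<close>

text \<open>The normalised area measure is planar Lebesgue measure divided by \<open>pi\<close>, the area of the disc.\<close>

lemma nn_integral_weighted_area:
  fixes \<gamma> :: real and h :: "complex \<Rightarrow> ennreal"
  assumes \<gamma>: "\<gamma> > -1" and h: "h \<in> borel_measurable (restrict_space borel unit_disc)"
  shows "(\<integral>\<^sup>+z. h z \<partial>weighted_area \<gamma>)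
      = ennreal ((\<gamma> + 1) / pi) * (\<integral>\<^sup>+z. ennreal ((1 - (cmod z)\<^sup>2) powr \<gamma>) * h z * indicator unit_disc z \<partial>lborel)"
proof -
  let ?R = "restrict_space lborel unit_disc :: complex measure"
  have "sets ?R = sets (restrict_space borel unit_disc)"
    by (intro sets_restrict_space_cong) simp
  then have R: "borel_measurable ?R = borel_measurable (restrict_space borel unit_disc)"
    by (intro measurable_cong_sets) auto
  have m [measurable]: "h \<in> borel_measurable ?R" using h R by simp
  have wt [measurable]: "(\<lambda>z. ennreal ((1 - (cmod z)\<^sup>2) powr \<gamma>)) \<in> borel_measurable ?R"
    by (rule measurable_restrict_space1) measurable
  have wt' [measurable]: "(\<lambda>z. ennreal ((\<gamma> + 1) * (1 - (cmod z)\<^sup>2) powr \<gamma>)) \<in> borel_measurable ?R"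
    by (rule measurable_restrict_space1) measurable
  have D [measurable]: "unit_disc \<in> sets ?R" by (auto simp: sets_restrict_space intro!: image_eqI[of _ _ unit_disc])
  have eD: "emeasure ?R unit_disc = ennreal pi"
    by (simp add: emeasure_restrict_space emeasure_ball unit_ball_vol_2)
  have "(\<integral>\<^sup>+z. h z \<partial>weighted_area \<gamma>) = (\<integral>\<^sup>+z. ennreal ((\<gamma> + 1) * (1 - (cmod z)\<^sup>2) powr \<gamma>) * h z \<partial>area_measure)"
    unfolding weighted_area_def area_measure_def by (rule nn_integral_density) simp_all
  also have "\<dots> = (\<integral>\<^sup>+z. ennreal ((\<gamma> + 1) * (1 - (cmod z)\<^sup>2) powr \<gamma>) * h z * indicator unit_disc z \<partial>?R) / ennreal pi"
    unfolding area_measure_def eD[symmetric] by (rule nn_integral_uniform_measure) measurable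
  also have "(\<integral>\<^sup>+z. ennreal ((\<gamma> + 1) * (1 - (cmod z)\<^sup>2) powr \<gamma>) * h z * indicator unit_disc z \<partial>?R)
      = (\<integral>\<^sup>+z. ennreal (\<gamma> + 1) * (ennreal ((1 - (cmod z)\<^sup>2) powr \<gamma>) * h z * indicator unit_disc z) \<partial>?R)"
    using \<gamma> by (intro nn_integral_cong) (simp add: ennreal_mult mult.assoc)
  also have "\<dots> = ennreal (\<gamma> + 1) * (\<integral>\<^sup>+z. ennreal ((1 - (cmod z)\<^sup>2) powr \<gamma>) * h z * indicator unit_disc z \<partial>?R)"
    by (rule nn_integral_cmult) measurable
  also have "(\<integral>\<^sup>+z. ennreal ((1 - (cmod z)\<^sup>2) powr \<gamma>) * h z * indicator unit_disc z \<partial>?R)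
      = (\<integral>\<^sup>+z. ennreal ((1 - (cmod z)\<^sup>2) powr \<gamma>) * h z * indicator unit_disc z \<partial>lborel)" (is "_ = ?I")
    by (subst nn_integral_restrict_space) (auto intro!: nn_integral_cong simp: indicator_def)
  also have "ennreal (\<gamma> + 1) * ?I / ennreal pi = ennreal ((\<gamma> + 1) / pi) * ?I"
  proof -
    have "ennreal (\<gamma> + 1) * ?I / ennreal pi = ennreal (\<gamma> + 1) * ennreal (inverse pi) * ?I"
      by (simp add: divide_ennreal_def inverse_ennreal mult_ac)
    also have "ennreal (\<gamma> + 1) * ennreal (inverse pi) = ennreal ((\<gamma> + 1) / pi)"
      using \<gamma> by (simp add: ennreal_mult[symmetric] divide_inverse)
    finally show ?thesis .
  qed
  finally show ?thesis .
qed

lemma space_weighted_area [simp]: "space (weighted_area \<gamma>) = unit_disc"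
  by (simp add: weighted_area_def area_measure_def space_restrict_space)

lemma measurable_powr_norm_disc:
  assumes "g holomorphic_on unit_disc" "p > 0"
  shows "(\<lambda>z. ennreal (cmod (g z) powr p)) \<in> borel_measurable (restrict_space borel unit_disc)"
  using assms
  by (intro measurable_compose[OF _ measurable_ennreal] borel_measurable_continuous_on_restrict
        continuous_on_powr' continuous_intros holomorphic_on_imp_continuous_on) auto

text \<open>The kernel \<open>G\<close> is symmetric, so by Tonelli's theorem \<open>k z\<close> and \<open>k w\<close> contribute equally. In
  each contribution, one variable is integrated out by the kernel estimate, which leaves
  the weight with exponent \<open>b + (b + 2 - p)\<close>.\<close>

lemma disc_gauge_double_integral_le:
  fixes b p :: real and k :: "complex \<Rightarrow> ennreal"
  assumes k [measurable]: "k \<in> borel_measurable borel" and b: "b > -1"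
    and C: "C > 0" "\<And>z. z \<in> unit_disc \<Longrightarrow>
      (\<integral>\<^sup>+w. ennreal ((1 - (cmod w)\<^sup>2) powr b * disc_gauge z w powr (- p)) * indicator unit_disc w \<partial>lborel)
      \<le> ennreal (C * (1 - (cmod z)\<^sup>2) powr (b + 2 - p))"
  defines "G \<equiv> \<lambda>z w. ennreal ((1 - (cmod z)\<^sup>2) powr b * ((1 - (cmod w)\<^sup>2) powr b * disc_gauge z w powr (- p)))
      * (indicator unit_disc z * indicator unit_disc w)"
  shows "(\<integral>\<^sup>+w. \<integral>\<^sup>+z. G z w * (k z + k w) \<partial>lborel \<partial>lborel)
      \<le> ennreal (2 * C) * (\<integral>\<^sup>+z. ennreal ((1 - (cmod z)\<^sup>2) powr (2 * b + 2 - p)) * k z * indicator unit_disc z \<partial>lborel)"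
proof -
  have measurable_G_pair: "(\<lambda>x. G (f x) (g x)) \<in> borel_measurable M"
    if [measurable]: "f \<in> borel_measurable M" "g \<in> borel_measurable M" for f g and M :: "(complex \<times> complex) measure"
    unfolding G_def by measurable
  have measurable_G: "(\<lambda>x. G (f x) (g x)) \<in> borel_measurable M"
    if [measurable]: "f \<in> borel_measurable M" "g \<in> borel_measurable M" for f g and M :: "complex measure"
    unfolding G_def by measurable
  have sym: "G z w = G w z" for z w
    by (simp add: G_def disc_gauge_commute[of z w] mult_ac)
  have mk: "(\<lambda>(w, z). G z w * k z) \<in> borel_measurable (lborel \<Otimes>\<^sub>M lborel)"
    unfolding split_beta' by (intro borel_measurable_times_ennreal measurable_G_pair) measurable
  let ?I = "\<integral>\<^sup>+z. ennreal ((1 - (cmod z)\<^sup>2) powr (2 * b + 2 - p)) * k z * indicator unit_disc z \<partial>lborel"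
  have slice: "(\<integral>\<^sup>+w. G z w * k z \<partial>lborel)
      \<le> ennreal C * (ennreal ((1 - (cmod z)\<^sup>2) powr (2 * b + 2 - p)) * k z * indicator unit_disc z)" for z
  proof (cases "z \<in> unit_disc")
    case True
    define W where "W = (1 - (cmod z)\<^sup>2) powr b"
    have W: "W \<ge> 0" by (simp add: W_def)
    have "(\<integral>\<^sup>+w. G z w * k z \<partial>lborel) = (\<integral>\<^sup>+w. (ennreal W * k z) *
        (ennreal ((1 - (cmod w)\<^sup>2) powr b * disc_gauge z w powr (- p)) * indicator unit_disc w) \<partial>lborel)"
      using True by (intro nn_integral_cong) (simp add: G_def W_def ennreal_mult mult_ac)
    also have "\<dots> = (ennreal W * k z) * (\<integral>\<^sup>+w. ennreal ((1 - (cmod w)\<^sup>2) powr b * disc_gauge z w powr (- p))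
        * indicator unit_disc w \<partial>lborel)"
      by (rule nn_integral_cmult) measurable
    also have "\<dots> \<le> (ennreal W * k z) * ennreal (C * (1 - (cmod z)\<^sup>2) powr (b + 2 - p))"
      using True by (intro mult_left_mono C(2)) auto
    also have "\<dots> = ennreal C * (ennreal (W * (1 - (cmod z)\<^sup>2) powr (b + 2 - p)) * k z)"
      using C(1) W by (simp add: ennreal_mult mult_ac)
    also have "W * (1 - (cmod z)\<^sup>2) powr (b + 2 - p) = (1 - (cmod z)\<^sup>2) powr (2 * b + 2 - p)"
      by (simp add: W_def powr_add[symmetric] algebra_simps)
    finally show ?thesis using True by simp
  qed (simp add: G_def)
  have "(\<integral>\<^sup>+z. \<integral>\<^sup>+w. G z w * k z \<partial>lborel \<partial>lborel)
      \<le> (\<integral>\<^sup>+z. ennreal C * (ennreal ((1 - (cmod z)\<^sup>2) powr (2 * b + 2 - p)) * k z * indicator unit_disc z) \<partial>lborel)"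
    by (intro nn_integral_mono slice)
  also have "\<dots> = ennreal C * ?I"
    by (rule nn_integral_cmult) measurable
  finally have main: "(\<integral>\<^sup>+z. \<integral>\<^sup>+w. G z w * k z \<partial>lborel \<partial>lborel) \<le> ennreal C * ?I" .
  have "(\<integral>\<^sup>+w. \<integral>\<^sup>+z. G z w * (k z + k w) \<partial>lborel \<partial>lborel)
      = (\<integral>\<^sup>+w. (\<integral>\<^sup>+z. G z w * k z \<partial>lborel) + (\<integral>\<^sup>+z. G w z * k w \<partial>lborel) \<partial>lborel)"
    by (intro nn_integral_cong, subst nn_integral_add[symmetric])
       (auto intro!: nn_integral_cong borel_measurable_times_ennreal measurable_G simp: distrib_left sym)
  also have "\<dots> = (\<integral>\<^sup>+w. \<integral>\<^sup>+z. G z w * k z \<partial>lborel \<partial>lborel) + (\<integral>\<^sup>+w. \<integral>\<^sup>+z. G w z * k w \<partial>lborel \<partial>lborel)"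
  proof (rule nn_integral_add)
    show "(\<lambda>w. \<integral>\<^sup>+z. G z w * k z \<partial>lborel) \<in> borel_measurable lborel"
      by (rule lborel.borel_measurable_nn_integral[OF mk])
    have "(\<lambda>(w, z). G w z * k w) \<in> borel_measurable (lborel \<Otimes>\<^sub>M lborel)"
      unfolding split_beta' by (intro borel_measurable_times_ennreal measurable_G_pair) measurable
    then show "(\<lambda>w. \<integral>\<^sup>+z. G w z * k w \<partial>lborel) \<in> borel_measurable lborel"
      by (rule lborel.borel_measurable_nn_integral)
  qed
  also have "(\<integral>\<^sup>+w. \<integral>\<^sup>+z. G z w * k z \<partial>lborel \<partial>lborel) = (\<integral>\<^sup>+z. \<integral>\<^sup>+w. G z w * k z \<partial>lborel \<partial>lborel)"
    using lborel_pair.Fubini'[OF mk] by simp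
  also have "(\<integral>\<^sup>+z. \<integral>\<^sup>+w. G z w * k z \<partial>lborel \<partial>lborel) + (\<integral>\<^sup>+w. \<integral>\<^sup>+z. G w z * k w \<partial>lborel \<partial>lborel)
      \<le> ennreal C * ?I + ennreal C * ?I"
    by (intro add_mono main)
  also have "\<dots> = ennreal (2 * C) * ?I"
    using C(1) by (simp add: ennreal_mult mult.assoc mult_2[symmetric])
  finally show ?thesis .
qed

theorem theorem12:
  fixes \<alpha> \<beta> p :: real
  assumes "\<alpha> > -1" and "p > \<alpha> + 2" and "2 * (\<beta> + 1) = p + \<alpha>"
  shows "\<exists>C::real. C > 0 \<and>
    (\<forall>f \<in> bergman_space p \<alpha>.
       symmetric_lifting f \<in> bergman_space2 p \<beta> \<and>
       bergman_int2 p \<beta> (symmetric_lifting f) \<le> ennreal C * bergman_int p \<alpha> f)"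
proof -
  have \<beta>: "\<beta> > -1" "p > \<beta> + 2" "2 * \<beta> + 2 - p = \<alpha>" and p: "p \<ge> 1" "p > 0"
    using assms by auto
  obtain C where C: "C > 0" "\<And>z. z \<in> unit_disc \<Longrightarrow>
      (\<integral>\<^sup>+w. ennreal ((1 - (cmod w)\<^sup>2) powr \<beta> * disc_gauge z w powr (- p)) * indicator unit_disc w \<partial>lborel)
      \<le> ennreal (C * (1 - (cmod z)\<^sup>2) powr (\<beta> + 2 - p))"
    using disc_gauge_integral[OF \<beta>(1,2)] by blast
  define K where "K = (1 + 4 * 16 powr \<bar>\<beta>\<bar>) * 20 powr p"
  define ca cb where "ca = (\<alpha> + 1) / pi" and "cb = (\<beta> + 1) / pi"
  have pos: "K > 0" "ca > 0" "cb > 0"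
    using assms(1) \<beta>(1) by (auto simp: K_def ca_def cb_def intro!: mult_pos_pos add_pos_nonneg)
  define C' where "C' = cb * cb * K * (2 * C) / ca"
  have C': "C' > 0" using pos C(1) by (simp add: C'_def)
  have "symmetric_lifting f \<in> bergman_space2 p \<beta> \<and>
       bergman_int2 p \<beta> (symmetric_lifting f) \<le> ennreal C' * bergman_int p \<alpha> f"
    if "f \<in> bergman_space p \<alpha>" for f
  proof -
    have f: "f holomorphic_on unit_disc" and fin: "bergman_int p \<alpha> f < \<infinity>"
      using that by (auto simp: bergman_space_def)
    \<comment> \<open>Extended by zero, because nothing is known about \<open>f\<close> outside the disc.\<close>
    define k where "k = (\<lambda>z. ennreal (if z \<in> unit_disc then cmod (f z) powr p else 0))"
    have k [measurable]: "k \<in> borel_measurable borel"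
      unfolding k_def using p
      by (intro measurable_compose[OF _ measurable_ennreal] borel_measurable_continuous_on_if
            continuous_intros continuous_on_powr' holomorphic_on_imp_continuous_on[OF f]) auto
    have kf: "k z = ennreal (cmod (f z) powr p)" if "z \<in> unit_disc" for z
      using that by (simp add: k_def)
    let ?W = "\<lambda>z. (1 - (cmod z)\<^sup>2) powr \<beta>"
    let ?Q = "\<lambda>z w. ennreal (?W z * disc_gauge z w powr (- p)) * indicator unit_disc z * (k z + k w)"
    \<comment> \<open>Up to a constant \<open>H w\<close> bounds the inner integral, and it is measurable in \<open>w\<close> as an integral
      of a jointly measurable function.\<close>
    define H where "H = (\<lambda>w. \<integral>\<^sup>+z. ?Q z w \<partial>lborel)"
    have "(\<lambda>(w, z). ?Q z w) \<in> borel_measurable (borel \<Otimes>\<^sub>M lborel)"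
      unfolding split_beta' by measurable
    then have H [measurable]: "H \<in> borel_measurable borel"
      unfolding H_def by (rule lborel.borel_measurable_nn_integral)
    have inner: "(\<integral>\<^sup>+z. ennreal (cmod (symmetric_lifting f (z, w)) powr p) \<partial>weighted_area \<beta>)
        \<le> ennreal (cb * K) * H w" if w: "w \<in> unit_disc" for w
    proof -
      have hol: "(\<lambda>z. symmetric_lifting f (z, w)) holomorphic_on unit_disc"
        using f w by (intro symmetric_lifting_holomorphic_fst) auto
      have "(\<integral>\<^sup>+z. ennreal (cmod (symmetric_lifting f (z, w)) powr p) \<partial>weighted_area \<beta>)
          = ennreal cb * (\<integral>\<^sup>+z. ennreal (?W z * cmod (symmetric_lifting f (z, w)) powr p) * indicator unit_disc z \<partial>lborel)"
        unfolding cb_def nn_integral_weighted_area[OF \<beta>(1) measurable_powr_norm_disc[OF hol p(2)]]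
        by (simp add: ennreal_mult)
      also have "\<dots> \<le> ennreal cb * (\<integral>\<^sup>+z. ennreal K * (ennreal (?W z *
            ((cmod (f z) powr p + cmod (f w) powr p) * disc_gauge z w powr (- p))) * indicator unit_disc z) \<partial>lborel)"
        unfolding K_def by (intro mult_left_mono symmetric_lifting_slice_bound f p w) simp
      also have "(\<integral>\<^sup>+z. ennreal K * (ennreal (?W z *
            ((cmod (f z) powr p + cmod (f w) powr p) * disc_gauge z w powr (- p))) * indicator unit_disc z) \<partial>lborel)
          = (\<integral>\<^sup>+z. ennreal K * ?Q z w \<partial>lborel)"
      proof (rule nn_integral_cong)
        fix z :: complex
        have "ennreal (?W z * ((cmod (f z) powr p + cmod (f w) powr p) * disc_gauge z w powr (- p)))
            = ennreal (?W z * disc_gauge z w powr (- p)) * (k z + k w)" if "z \<in> unit_disc"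
          using that w by (simp add: kf ennreal_plus[symmetric] ennreal_mult[symmetric] mult_ac del: ennreal_plus)
        then show "ennreal K * (ennreal (?W z * ((cmod (f z) powr p + cmod (f w) powr p) * disc_gauge z w powr (- p)))
            * indicator unit_disc z) = ennreal K * ?Q z w"
          by (cases "z \<in> unit_disc") auto
      qed
      also have "\<dots> = ennreal K * H w"
        unfolding H_def by (rule nn_integral_cmult) measurable
      also have "ennreal cb * (ennreal K * H w) = ennreal (cb * K) * H w"
        using pos by (simp add: ennreal_mult mult.assoc)
      finally show ?thesis .
    qed
    let ?G = "\<lambda>z w. ennreal (?W z * (?W w * disc_gauge z w powr (- p))) * (indicator unit_disc z * indicator unit_disc w)"
    have "bergman_int2 p \<beta> (symmetric_lifting f) \<le> (\<integral>\<^sup>+w. ennreal (cb * K) * H w \<partial>weighted_area \<beta>)"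
      unfolding bergman_int2_def by (intro nn_integral_mono inner) simp
    also have "\<dots> = ennreal cb * (\<integral>\<^sup>+w. ennreal (?W w) * (ennreal (cb * K) * H w) * indicator unit_disc w \<partial>lborel)"
      unfolding cb_def by (rule nn_integral_weighted_area[OF \<beta>(1)], rule measurable_restrict_space1) measurable
    also have "(\<integral>\<^sup>+w. ennreal (?W w) * (ennreal (cb * K) * H w) * indicator unit_disc w \<partial>lborel)
        = (\<integral>\<^sup>+w. ennreal (cb * K) * (ennreal (?W w) * indicator unit_disc w * H w) \<partial>lborel)"
      by (simp add: mult_ac)
    also have "\<dots> = ennreal (cb * K) * (\<integral>\<^sup>+w. ennreal (?W w) * indicator unit_disc w * H w \<partial>lborel)"
      by (rule nn_integral_cmult) measurable
    also have "(\<integral>\<^sup>+w. ennreal (?W w) * indicator unit_disc w * H w \<partial>lborel)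
        = (\<integral>\<^sup>+w. \<integral>\<^sup>+z. ?G z w * (k z + k w) \<partial>lborel \<partial>lborel)"
    proof (rule nn_integral_cong)
      fix w :: complex
      have "ennreal (?W w) * indicator unit_disc w * H w = (\<integral>\<^sup>+z. ennreal (?W w) * indicator unit_disc w * ?Q z w \<partial>lborel)"
        unfolding H_def by (rule nn_integral_cmult[symmetric]) measurable
      also have "\<dots> = (\<integral>\<^sup>+z. ?G z w * (k z + k w) \<partial>lborel)"
        by (intro nn_integral_cong) (simp add: ennreal_mult mult_ac)
      finally show "ennreal (?W w) * indicator unit_disc w * H w = \<dots>" .
    qed
    also have "\<dots> \<le> ennreal (2 * C) * (\<integral>\<^sup>+z. ennreal ((1 - (cmod z)\<^sup>2) powr \<alpha>) * k z * indicator unit_disc z \<partial>lborel)"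
      using disc_gauge_double_integral_le[OF k \<beta>(1) C] unfolding \<beta>(3) .
    also have "(\<integral>\<^sup>+z. ennreal ((1 - (cmod z)\<^sup>2) powr \<alpha>) * k z * indicator unit_disc z \<partial>lborel)
        = ennreal (1 / ca) * bergman_int p \<alpha> f"
    proof -
      have "bergman_int p \<alpha> f = ennreal ca *
          (\<integral>\<^sup>+z. ennreal ((1 - (cmod z)\<^sup>2) powr \<alpha>) * ennreal (cmod (f z) powr p) * indicator unit_disc z \<partial>lborel)"
        unfolding bergman_int_def ca_def by (rule nn_integral_weighted_area[OF assms(1) measurable_powr_norm_disc[OF f p(2)]])
      also have "(\<integral>\<^sup>+z. ennreal ((1 - (cmod z)\<^sup>2) powr \<alpha>) * ennreal (cmod (f z) powr p) * indicator unit_disc z \<partial>lborel)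
          = (\<integral>\<^sup>+z. ennreal ((1 - (cmod z)\<^sup>2) powr \<alpha>) * k z * indicator unit_disc z \<partial>lborel)"
        by (intro nn_integral_cong) (auto simp: kf indicator_def)
      finally have "ennreal (1 / ca) * bergman_int p \<alpha> f = ennreal (1 / ca) * ennreal ca *
          (\<integral>\<^sup>+z. ennreal ((1 - (cmod z)\<^sup>2) powr \<alpha>) * k z * indicator unit_disc z \<partial>lborel)"
        by (simp add: mult.assoc)
      also have "ennreal (1 / ca) * ennreal ca = 1"
        using pos by (simp add: ennreal_mult[symmetric])
      finally show ?thesis by simp
    qed
    also have "ennreal cb * (ennreal (cb * K) * (ennreal (2 * C) * (ennreal (1 / ca) * bergman_int p \<alpha> f)))
        = ennreal C' * bergman_int p \<alpha> f"
      using pos C(1) by (simp add: C'_def mult.assoc[symmetric] ennreal_mult[symmetric])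
    finally have le: "bergman_int2 p \<beta> (symmetric_lifting f) \<le> ennreal C' * bergman_int p \<alpha> f"
      by (simp add: mult_left_mono)
    have "ennreal C' * bergman_int p \<alpha> f < \<infinity>"
      using fin by (simp add: ennreal_mult_less_top)
    with le have "bergman_int2 p \<beta> (symmetric_lifting f) < \<infinity>" by (rule le_less_trans)
    with le f show ?thesis
      by (simp add: bergman_space2_def symmetric_lifting_holomorphic2)
  qed
  with C' show ?thesis by blast
qed

end
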